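(* Let $v\in C^4((0,T])$ and let $v_{\mathbf 2}^n$ be the solution of the BDF2 scheme. If $\tau\le 1/(4L_f)$ and $f\in C^2$, the solution $v_{\mathbf 3}^n$ of the BDF2-DC3 scheme is mesh-robustly convergent: $$|e_{\mathbf 3}^n|\le C\exp(4L_ft_{n-1})\Big(|e_{\mathbf 3}^{1}|+\tau|\partial_\tau e_{\mathbf 3}^1|+\tau|e_{\mathbf 2}^1|+\tau(\tau+\sigma_{\mathbf 3}^n)|\partial_\tau e_{\mathbf 2}^1|+t_n\tau^3\Big),\quad 2\le n\le N,$$ where $C>0$ is independent of the time-step sizes $\tau_n$ and of the step ratios $r_n$.
   Context: Problem: $v'(t)=f(t,v)$ for $0<t\le T$, $v(0)=v_0$, where $f$ is Lipschitz-continuous in $v$ with Lipschitz constant $L_f>0$; $v(t)$ denotes its exact solution. Mesh: $0=t_0<t_1<\cdots<t_N=T$ is an arbitrary mesh, $\tau_k:=t_k-t_{k-1}$ for $1\le k\le N$, $\tau:=\max_{1\le k\le N}\tau_k$, $r_k:=\tau_k/\tau_{k-1}$ for $k\ge2$. For a sequence $(w^n)$ put $\partial_\tau w^n:=(w^n-w^{n-1})/\tau_n$. BDF2 operator: $D_2w^n:=\sum_{j=1}^n d^{(n)}_{n-j}\partial_\tau w^j$ for $n\ge2$, with $d^{(n)}_0:=\frac{1+2r_n}{1+r_n}$, $d^{(n)}_1:=-\frac{r_n}{1+r_n}$, $d^{(n)}_j:=0$ for $j\ge2$. DOC kernels: $\vartheta_0^{(n)}:=1/d_0^{(n)}$ and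 $\vartheta_{n-j}^{(n)}:=-\frac1{d_0^{(j)}}\sum_{i=j+1}^n\vartheta_{n-i}^{(n)}d^{(i)}_{i-j}$ for $2\le j\le n-1$. For $n\ge2$ define $\sigma_{\mathbf 2}^n:=\prod_{\ell=2}^n\frac{r_\ell}{1+2r_\ell}$ and $\sigma_{\mathbf 3}^n:=\sum_{i=2}^n\vartheta_{n-i}^{(n)}\sigma_{\mathbf 2}^i$. Third-order correction: $\mathcal D_{2,3}f(t_n,w^n):=\frac13\big[r_n(\tau_n+\tau_{n-1})^2-(1+r_n)\tau_n^2\big]\,f[t_n,t_{n-1},t_{n-2}]$ for $n\ge2$, where $f[\cdot,\cdot,\cdot]$ is the Newton divided difference of the data $f(t_k,w^k)$ at $t_k$; equivalently $\mathcal D_{2,3}f(t_n,w^n)=\frac{\tau_n}{3}\big(\partial_\tau f(t_n,w^n)-\partial_\tau f(t_{n-1},w^{n-1})\big)$. Schemes, with $v_{\mathbf 2}^0=v_{\mathbf 3}^0=v_0$ and given starting values $v_{\mathbf 2}^1,v_{\mathbf 3}^1$: BDF2: $D_2v_{\mathbf 2}^n=f(t_n,v_{\mathbf 2}^n)$ for $n\ge2$; BDF2-DC3: $D_2v_{\mathbf 3}^n+\mathcal D_{2,3}f(t_n,v_{\mathbf 2}^n)=f(t_n,v_{\mathbf 3}^n)$ for $n\ge2$. Errors: $e_{\mathbf q}^0:=0$, $e_{\mathbf q}^i:=v(t_i)-v_{\mathbf q}^i$ for $\mathbf q=\mathbf 2,\mathbf 3$ and $1\le i\le N$. Convention: $C$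 denotes a generic positive constant which may depend on the given data, the solution and the length of the integration interval, but is always independent of the time-step sizes $\tau_n$ and the step ratios $r_n$. The starting values are always assumed available and accurate. A convergence estimate is called mesh-robust if its prefactor is independent of the step ratios $r_n$.
   Formalization: The fourth derivative of v is assumed bounded on (0,T); without this the bound fails, e.g. for f=t^{5/2}. Accuracy of starting values is read as |e_2^1|≤M and τ|∂_τ e_2^1|≤M, with C allowed to depend on M. *)

theory Defs
  imports "HOL-Analysis.Analysis"
begin

section \<open>Smoothness classes\<close>

text \<open>
  \<open>Ck_on k S g\<close>: the function \<open>g\<close> is \<open>k\<close> times continuously differentiable on \<open>S\<close>.  The
  functions \<open>G b\<close> are the partial derivatives of \<open>g\<close> along the basis directions; derivatives
  are taken within \<open>S\<close>, so they are one-sided at boundary points belonging to \<open>S\<close>.  The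
  definition is meant for convex sets with nonempty interior, where the derivatives within
  \<open>S\<close> are unique.  Nothing is said about boundedness.
\<close>

primrec Ck_on :: "nat \<Rightarrow> 'a::euclidean_space set \<Rightarrow> ('a \<Rightarrow> real) \<Rightarrow> bool" where
  "Ck_on 0 S g \<longleftrightarrow> continuous_on S g"
| "Ck_on (Suc k) S g \<longleftrightarrow>
     (\<exists>G. (\<forall>p\<in>S. (g has_derivative (\<lambda>h. \<Sum>b\<in>Basis. (h \<bullet> b) * G b p)) (at p within S)) \<and>
          (\<forall>b\<in>Basis. Ck_on k S (G b)))"

section \<open>Meshes and difference quotients\<close>

text \<open>
  Meshes and grid functions are sequences \<open>nat \<Rightarrow> real\<close>; only the entries with index at most
  \<open>N\<close> matter.
\<close>

definition is_mesh :: "real \<Rightarrow> nat \<Rightarrow> (nat \<Rightarrow> real) \<Rightarrow> bool" where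
  "is_mesh T N t \<longleftrightarrow> N \<ge> 1 \<and> t 0 = 0 \<and> t N = T \<and> (\<forall>k\<in>{1..N}. t (k - 1) < t k)"

definition step :: "(nat \<Rightarrow> real) \<Rightarrow> nat \<Rightarrow> real" where
  "step t k = t k - t (k - 1)"

definition max_step :: "nat \<Rightarrow> (nat \<Rightarrow> real) \<Rightarrow> real" where
  "max_step N t = Max (step t ` {1..N})"

definition ratio :: "(nat \<Rightarrow> real) \<Rightarrow> nat \<Rightarrow> real" where
  "ratio t k = step t k / step t (k - 1)"

definition dq :: "(nat \<Rightarrow> real) \<Rightarrow> (nat \<Rightarrow> real) \<Rightarrow> nat \<Rightarrow> real" where
  "dq t w n = (w n - w (n - 1)) / step t n"

text \<open>The Newton divided difference of the data \<open>g k\<close> at \<open>t k\<close> over \<open>t n\<close>, \<open>t (n - 1)\<close>, \<open>t (n - 2)\<close>.\<close>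

definition divdiff3 :: "(nat \<Rightarrow> real) \<Rightarrow> (nat \<Rightarrow> real) \<Rightarrow> nat \<Rightarrow> real" where
  "divdiff3 t g n =
     ((g n - g (n - 1)) / (t n - t (n - 1)) - (g (n - 1) - g (n - 2)) / (t (n - 1) - t (n - 2)))
       / (t n - t (n - 2))"

section \<open>The BDF2 operator and its orthogonal convolution kernels\<close>

definition bdf2_kernel :: "(nat \<Rightarrow> real) \<Rightarrow> nat \<Rightarrow> nat \<Rightarrow> real" where
  "bdf2_kernel t n j =
     (if j = 0 then (1 + 2 * ratio t n) / (1 + ratio t n)
      else if j = 1 then - (ratio t n / (1 + ratio t n))
      else 0)"

definition BDF2 :: "(nat \<Rightarrow> real) \<Rightarrow> (nat \<Rightarrow> real) \<Rightarrow> nat \<Rightarrow> real" where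
  "BDF2 t w n = (\<Sum>j=1..n. bdf2_kernel t n (n - j) * dq t w j)"

text \<open>
  \<open>doc_kernel t n k\<close> is the DOC kernel with upper index \<open>n\<close> and lower index \<open>k\<close>.  With
  \<open>j = n - k\<close> the second case is the usual recursion; it is meaningful for \<open>2 \<le> j \<le> n - 1\<close>.
\<close>

function doc_kernel :: "(nat \<Rightarrow> real) \<Rightarrow> nat \<Rightarrow> nat \<Rightarrow> real" where
  "doc_kernel t n k =
     (if k = 0 then 1 / bdf2_kernel t n 0
      else let j = n - k in
        - (1 / bdf2_kernel t j 0) *
          (\<Sum>i=j+1..n. doc_kernel t n (n - i) * bdf2_kernel t i (i - j)))"
  by pat_completeness auto
termination
  by (relation "inv_image less_than (\<lambda>(t, n, k). k)") auto

declare doc_kernel.simps [simp del]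

definition sigma2 :: "(nat \<Rightarrow> real) \<Rightarrow> nat \<Rightarrow> real" where
  "sigma2 t n = (\<Prod>l=2..n. ratio t l / (1 + 2 * ratio t l))"

definition sigma3 :: "(nat \<Rightarrow> real) \<Rightarrow> nat \<Rightarrow> real" where
  "sigma3 t n = (\<Sum>i=2..n. doc_kernel t n (n - i) * sigma2 t i)"

section \<open>The two schemes\<close>

text \<open>The correction operator, applied to the data \<open>f (t k) (w k)\<close>.\<close>

definition DC23 :: "(real \<Rightarrow> real \<Rightarrow> real) \<Rightarrow> (nat \<Rightarrow> real) \<Rightarrow> (nat \<Rightarrow> real) \<Rightarrow> nat \<Rightarrow> real" where
  "DC23 f t w n =
     1 / 3 * (ratio t n * (step t n + step t (n - 1))\<^sup>2 - (1 + ratio t n) * (step t n)\<^sup>2)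
       * divdiff3 t (\<lambda>k. f (t k) (w k)) n"

text \<open>
  The entries with index 1 are the starting values; they are not constrained by the schemes.
\<close>

definition bdf2_solution ::
  "(real \<Rightarrow> real \<Rightarrow> real) \<Rightarrow> real \<Rightarrow> nat \<Rightarrow> (nat \<Rightarrow> real) \<Rightarrow> (nat \<Rightarrow> real) \<Rightarrow> bool" where
  "bdf2_solution f v0 N t v2 \<longleftrightarrow>
     v2 0 = v0 \<and> (\<forall>n\<in>{2..N}. BDF2 t v2 n = f (t n) (v2 n))"

definition bdf2_dc3_solution ::
  "(real \<Rightarrow> real \<Rightarrow> real) \<Rightarrow> real \<Rightarrow> nat \<Rightarrow> (nat \<Rightarrow> real) \<Rightarrow> (nat \<Rightarrow> real) \<Rightarrow> (nat \<Rightarrow> real) \<Rightarrow> bool" where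
  "bdf2_dc3_solution f v0 N t v2 v3 \<longleftrightarrow>
     v3 0 = v0 \<and> (\<forall>n\<in>{2..N}. BDF2 t v3 n + DC23 f t v2 n = f (t n) (v3 n))"

definition err :: "(real \<Rightarrow> real) \<Rightarrow> (nat \<Rightarrow> real) \<Rightarrow> (nat \<Rightarrow> real) \<Rightarrow> nat \<Rightarrow> real" where
  "err v t w i = (if i = 0 then 0 else v (t i) - w i)"

section \<open>The initial value problem\<close>

definition ivp_solution :: "(real \<Rightarrow> real \<Rightarrow> real) \<Rightarrow> real \<Rightarrow> real \<Rightarrow> (real \<Rightarrow> real) \<Rightarrow> bool" where
  "ivp_solution f v0 T v \<longleftrightarrow>
     v 0 = v0 \<and> continuous_on {0..T} v \<and>
     (\<forall>s\<in>{0<..T}. (v has_real_derivative f s (v s)) (at s within {0..T}))"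

end

theory Submission
  imports Defs
begin

text \<open>
  Write \<open>\<rho>\<^sub>n = r\<^sub>n / (1 + 2 r\<^sub>n)\<close>, which lies in \<open>[0, 1/2]\<close> for every step ratio.  The BDF2
  equation \<open>D\<^sub>2 e\<^sup>n = F\<^sub>n\<close> says that the difference quotient of \<open>e\<close> at \<open>n\<close> is the convex
  combination of the quotient at \<open>n - 1\<close> and of \<open>F\<^sub>n\<close> with weights \<open>\<rho>\<^sub>n\<close> and \<open>1 - \<rho>\<^sub>n\<close>.  Hence
  the influence of the initial quotient decays like \<open>2\<^sup>-\<^sup>n\<close>, and a discrete Gronwall argument gives
  bounds for both the errors and their difference quotients that do not see the step ratios.

  For BDF2 the truncation error is \<open>O(\<tau>\<^sup>2)\<close>.  For BDF2-DC3 it is \<open>O(\<tau>\<^sup>3)\<close> plus the correction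
  operator applied to \<open>h\<^sub>k = f(t\<^sub>k, v(t\<^sub>k)) - f(t\<^sub>k, v\<^sub>2\<^sup>k)\<close>.  Since \<open>f\<close> is \<open>C\<^sup>2\<close>, the difference quotients
  of \<open>h\<close> are bounded by the errors and error quotients of BDF2; the part decaying like \<open>2\<^sup>-\<^sup>k\<close>
  contributes only \<open>O(\<tau>\<^sup>2)\<close> times the initial quotient after summation.  The term with
  \<open>\<sigma>\<^sub>3\<close> is therefore only needed to be nonnegative.
\<close>

section \<open>Stability of the convex recursion\<close>

text \<open>The sum reaches \<open>E n\<close> itself, so the bound is implicit. With
  \<open>S\<close> for the right-hand side and \<open>h\<close> for the step,
  \<open>(1 - L * h) * S (Suc k) \<le> S k + A * h\<close>, and
  \<open>1 / (1 - L * h) \<le> 1 + 2 * (L * h) \<le> exp (2 * L * h)\<close> because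
  \<open>L * h \<le> 1 / 4\<close>.\<close>

lemma implicit_gronwall:
  fixes t E :: "nat \<Rightarrow> real"
  assumes L: "L \<ge> 0" and A: "A \<ge> 0" and D: "D \<ge> 0"
    and mesh: "\<And>k. 1 \<le> k \<Longrightarrow> k < N \<Longrightarrow> t k \<le> t (Suc k) \<and> L * (t (Suc k) - t k) \<le> 1 / 4"
    and E: "\<And>n. 1 \<le> n \<Longrightarrow> n \<le> N \<Longrightarrow>
      E n \<le> D + A * (t n - t 1) + L * (\<Sum>k\<in>{1..<n}. (t (Suc k) - t k) * E (Suc k))"
    and n: "1 \<le> n" "n \<le> N"
  shows "E n \<le> exp (2 * L * (t n - t 1)) * (D + A * (t n - t 1))"
proof -
  define S where "S n = D + A * (t n - t 1) + L * (\<Sum>k\<in>{1..<n}. (t (Suc k) - t k) * E (Suc k))" for n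
  have "t 1 \<le> t n \<and> S n \<le> exp (2 * L * (t n - t 1)) * (D + A * (t n - t 1))"
    using n
  proof (induction n rule: dec_induct)
    case base
    then show ?case by (simp add: S_def)
  next
    case (step k)
    define h where "h = t (Suc k) - t k"
    have h: "h \<ge> 0" "L * h \<le> 1 / 4" "L * h \<ge> 0"
      using mesh[of k] step L by (auto simp: h_def)
    have IH: "t 1 \<le> t k" "S k \<le> exp (2 * L * (t k - t 1)) * (D + A * (t k - t 1))"
      using step by auto
    have "S (Suc k) = S k + A * h + L * h * E (Suc k)"
      using step by (simp add: S_def h_def algebra_simps)
    moreover have "E (Suc k) \<le> S (Suc k)"
      using E[of "Suc k"] step by (simp add: S_def)
    ultimately have "S (Suc k) \<le> S k + A * h + L * h * S (Suc k)"
      using h(3) mult_left_mono by fastforce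
    then have S: "(1 - L * h) * S (Suc k) \<le> S k + A * h"
      by (simp add: algebra_simps)
    have "1 \<le> (1 - L * h) * (1 + 2 * (L * h))"
    proof -
      have "(1 - L * h) * (1 + 2 * (L * h)) = 1 + L * h * (1 - 2 * (L * h))"
        by (simp add: algebra_simps)
      then show ?thesis using h by simp
    qed
    also have "\<dots> \<le> (1 - L * h) * exp (2 * L * h)"
      using h exp_ge_add_one_self[of "2 * L * h"] by (intro mult_left_mono) (auto simp: mult.assoc)
    finally have one: "1 / (1 - L * h) \<le> exp (2 * L * h)"
      using h by (simp add: divide_simps mult.commute)
    have pos: "D + A * (t k - t 1) \<ge> 0" "A * h \<ge> 0"
      using IH A D h by auto
    have "S k + A * h \<le> exp (2 * L * (t k - t 1)) * (D + A * (t k - t 1)) + 1 * (A * h)"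
      using IH by simp
    also have "\<dots> \<le> exp (2 * L * (t k - t 1)) * (D + A * (t k - t 1)) + exp (2 * L * (t k - t 1)) * (A * h)"
      using IH L pos by (intro add_left_mono mult_right_mono) auto
    also have "\<dots> = exp (2 * L * (t k - t 1)) * (D + A * (t (Suc k) - t 1))"
      by (simp add: h_def algebra_simps)
    finally have up: "S k + A * h \<le> exp (2 * L * (t k - t 1)) * (D + A * (t (Suc k) - t 1))" .
    have "S (Suc k) \<le> (S k + A * h) / (1 - L * h)"
      using S h by (simp add: divide_simps mult.commute)
    also have "\<dots> \<le> exp (2 * L * (t k - t 1)) * (D + A * (t (Suc k) - t 1)) * (1 / (1 - L * h))"
      using up h by (simp add: divide_right_mono)
    also have "\<dots> \<le> exp (2 * L * (t k - t 1)) * (D + A * (t (Suc k) - t 1)) * exp (2 * L * h)"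
      using one pos h A by (intro mult_left_mono mult_nonneg_nonneg) (auto simp: h_def algebra_simps)
    also have "\<dots> = exp (2 * L * (t (Suc k) - t 1)) * (D + A * (t (Suc k) - t 1))"
      by (simp add: h_def mult_exp_exp algebra_simps flip: exp_add)
    finally show ?case using IH h by (auto simp: h_def)
  qed
  moreover have "E n \<le> S n" using E[OF n] by (simp add: S_def)
  ultimately show ?thesis by linarith
qed

text \<open>Here \<open>x\<close> stands for the difference quotients of \<open>e\<close>. A weight
  of at most 1/2 at least halves the inherited quotient in each step, so \<open>x 1\<close> and the
  perturbations \<open>B / 2 ^ k\<close> leave summable traces. What persists,
  \<open>L * \<bar>e\<bar> + A\<close>, is left to \<open>implicit_gronwall\<close>.\<close>

lemma convex_recursion_stability:
  fixes t e x F \<rho> :: "nat \<Rightarrow> real"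
  assumes L: "L \<ge> 0" and A: "A \<ge> 0" and B: "B \<ge> 0" and L\<tau>: "L * \<tau> \<le> 1 / 4"
    and mesh: "\<And>k. 1 \<le> k \<Longrightarrow> k < N \<Longrightarrow> t k \<le> t (Suc k) \<and> t (Suc k) - t k \<le> \<tau>"
    and \<rho>: "\<And>k. 1 \<le> k \<Longrightarrow> k < N \<Longrightarrow> 0 \<le> \<rho> (Suc k) \<and> \<rho> (Suc k) \<le> 1 / 2"
    and e: "\<And>k. 1 \<le> k \<Longrightarrow> k < N \<Longrightarrow> e (Suc k) = e k + (t (Suc k) - t k) * x (Suc k)"
    and x: "\<And>k. 1 \<le> k \<Longrightarrow> k < N \<Longrightarrow> x (Suc k) = \<rho> (Suc k) * x k + (1 - \<rho> (Suc k)) * F (Suc k)"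
    and F: "\<And>k. 1 \<le> k \<Longrightarrow> k < N \<Longrightarrow> \<bar>F (Suc k)\<bar> \<le> L * \<bar>e (Suc k)\<bar> + A + B / 2 ^ Suc k"
    and \<tau>: "\<tau> \<ge> 0"
    and n: "1 \<le> n" "n \<le> N"
  defines "W \<equiv> exp (2 * L * (t n - t 1)) * (\<bar>e 1\<bar> + \<tau> * \<bar>x 1\<bar> + 2 * \<tau> * B + A * (t n - t 1))"
  shows "\<bar>e n\<bar> \<le> W" and "\<bar>x n\<bar> \<le> \<bar>x 1\<bar> / 2 ^ (n - 1) + L * W + A + B * n / 2 ^ n"
proof -
  \<comment> \<open>The running maximum is monotone, so \<open>L * E k\<close> may be raised to
    \<open>L * E (Suc k)\<close> in both parts of the convex combination, whose weights then add up
    to 1 without growth.\<close>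
  define E where "E k = Max ((\<lambda>j. \<bar>e j\<bar>) ` {1..k})" for k
  have eE: "\<bar>e j\<bar> \<le> E k" if "1 \<le> j" "j \<le> k" for j k
    unfolding E_def using that by (intro Max_ge) auto
  have E_attained: "\<exists>j\<in>{1..k}. E k = \<bar>e j\<bar>" if "1 \<le> k" for k
  proof -
    have "E k \<in> (\<lambda>j. \<bar>e j\<bar>) ` {1..k}"
      unfolding E_def using that by (intro Max_in) auto
    then show ?thesis by auto
  qed
  have E_mono: "E j \<le> E k" if "1 \<le> j" "j \<le> k" for j k
    using E_attained[of j] eE[of _ k] that by force
  have E0: "E k \<ge> 0" if "1 \<le> k" for k
    using eE[of 1 k] that by linarith
  \<comment> \<open>The factor \<open>n\<close> is a resonance: halving \<open>k / 2 ^ k\<close> and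
    adding a fresh \<open>1 / 2 ^ Suc k\<close> gives \<open>Suc k / 2 ^ Suc k\<close>.\<close>
  have xb: "\<bar>x n\<bar> \<le> \<bar>x 1\<bar> / 2 ^ (n - 1) + L * E n + A + B * n / 2 ^ n" if "1 \<le> n" "n \<le> N" for n
    using that
  proof (induction n rule: dec_induct)
    case base
    then show ?case using L E0[of 1] A B by simp
  next
    case (step k)
    let ?r = "\<rho> (Suc k)"
    have r: "0 \<le> ?r" "?r \<le> 1 / 2" using \<rho>[of k] step by auto
    have IH: "\<bar>x k\<bar> \<le> \<bar>x 1\<bar> / 2 ^ (k - 1) + L * E k + A + B * k / 2 ^ k"
      using step by auto
    have Ek: "L * E k \<le> L * E (Suc k)" "L * \<bar>e (Suc k)\<bar> \<le> L * E (Suc k)"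
      using L E_mono[of k "Suc k"] eE[of "Suc k" "Suc k"] step by (auto intro: mult_left_mono)
    have F': "\<bar>F (Suc k)\<bar> \<le> L * E (Suc k) + A + B / 2 ^ Suc k"
      using F[of k] Ek step by linarith
    have "\<bar>x (Suc k)\<bar> \<le> \<bar>?r * x k\<bar> + \<bar>(1 - ?r) * F (Suc k)\<bar>"
      using x[of k] step abs_triangle_ineq by simp
    also have "\<dots> = ?r * \<bar>x k\<bar> + (1 - ?r) * \<bar>F (Suc k)\<bar>"
      using r by (simp add: abs_mult)
    also have "\<dots> \<le> ?r * (\<bar>x 1\<bar> / 2 ^ (k - 1) + L * E (Suc k) + A + B * k / 2 ^ k)
        + (1 - ?r) * (L * E (Suc k) + A + B / 2 ^ Suc k)"
      using IH Ek F' r by (intro add_mono mult_left_mono) auto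
    also have "\<dots> = ?r * (\<bar>x 1\<bar> / 2 ^ (k - 1) + B * k / 2 ^ k) + L * E (Suc k) + A
        + (1 - ?r) * (B / 2 ^ Suc k)"
      by (simp add: algebra_simps)
    also have "\<dots> \<le> 1 / 2 * (\<bar>x 1\<bar> / 2 ^ (k - 1) + B * k / 2 ^ k) + L * E (Suc k) + A
        + 1 * (B / 2 ^ Suc k)"
      using r B by (intro add_mono mult_right_mono order_refl) auto
    also have "\<dots> = \<bar>x 1\<bar> / 2 ^ (Suc k - 1) + L * E (Suc k) + A + B * Suc k / 2 ^ Suc k"
      using step(1) by (cases k) (auto simp: field_simps)
    finally show ?case .
  qed
  have t_mono: "t j \<le> t k" if "1 \<le> j" "j \<le> k" "k \<le> N" for j k
    using that(2,3)
  proof (induction k rule: dec_induct)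
    case (step k)
    then show ?case using mesh[of k] that(1) by auto
  qed simp
  define S where "S n = (\<Sum>k\<in>{1..<n}. (t (Suc k) - t k) * E (Suc k))" for n
  define D where "D = \<bar>e 1\<bar> + \<tau> * \<bar>x 1\<bar> + 2 * \<tau> * B"
  \<comment> \<open>The two coefficients are the exact partial sums of \<open>1 / 2 ^ k\<close> up
    to \<open>n - 1\<close> and of \<open>k / 2 ^ k\<close> up to \<open>n\<close>; exactness lets
    the induction close. Only in these decaying terms is the step replaced by
    \<open>\<tau>\<close>.\<close>
  have eb: "\<bar>e n\<bar> \<le> \<bar>e 1\<bar> + \<tau> * \<bar>x 1\<bar> * (1 - 1 / 2 ^ (n - 1)) + \<tau> * B * (2 - (real n + 2) / 2 ^ n)
      + A * (t n - t 1) + L * S n" if "1 \<le> n" "n \<le> N" for n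
    using that
  proof (induction n rule: dec_induct)
    case base
    then show ?case using \<tau> B by (simp add: S_def)
  next
    case (step k)
    define h where "h = t (Suc k) - t k"
    have h: "0 \<le> h" "h \<le> \<tau>" using mesh[of k] step by (auto simp: h_def)
    have "\<bar>e (Suc k)\<bar> \<le> \<bar>e k\<bar> + h * \<bar>x (Suc k)\<bar>"
      using e[of k] step h abs_triangle_ineq[of "e k" "h * x (Suc k)"] by (simp add: h_def abs_mult)
    moreover have "h * \<bar>x (Suc k)\<bar> \<le>
        h * (\<bar>x 1\<bar> / 2 ^ k + L * E (Suc k) + A + B * Suc k / 2 ^ Suc k)"
      using xb[of "Suc k"] step h by (intro mult_left_mono) auto
    moreover have "\<dots> = h * (\<bar>x 1\<bar> / 2 ^ k + B * Suc k / 2 ^ Suc k) + (L * (h * E (Suc k)) + A * h)"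
      by (simp add: algebra_simps)
    moreover have "h * (\<bar>x 1\<bar> / 2 ^ k + B * Suc k / 2 ^ Suc k)
        \<le> \<tau> * (\<bar>x 1\<bar> / 2 ^ k + B * Suc k / 2 ^ Suc k)"
      using h B by (intro mult_right_mono) auto
    moreover have "\<bar>e k\<bar> \<le> \<bar>e 1\<bar> + \<tau> * \<bar>x 1\<bar> * (1 - 1 / 2 ^ (k - 1)) + \<tau> * B * (2 - (real k + 2) / 2 ^ k)
      + A * (t k - t 1) + L * S k"
      using step by simp
    ultimately have "\<bar>e (Suc k)\<bar> \<le> \<bar>e 1\<bar> + \<tau> * \<bar>x 1\<bar> * (1 - 1 / 2 ^ (k - 1)) + \<tau> * B * (2 - (real k + 2) / 2 ^ k)
      + A * (t k - t 1) + L * S k + (\<tau> * (\<bar>x 1\<bar> / 2 ^ k + B * Suc k / 2 ^ Suc k) + (L * (h * E (Suc k)) + A * h))"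
      by linarith
    also have "\<dots> = \<bar>e 1\<bar> + \<tau> * \<bar>x 1\<bar> * ((1 - 1 / 2 ^ (k - 1)) + 1 / 2 ^ k)
      + \<tau> * B * ((2 - (real k + 2) / 2 ^ k) + Suc k / 2 ^ Suc k)
      + (A * (t k - t 1) + A * h) + (L * S k + L * (h * E (Suc k)))"
      by (simp add: algebra_simps)
    also have "(1 - 1 / 2 ^ (k - 1)) + 1 / 2 ^ k = 1 - 1 / (2 :: real) ^ (Suc k - 1)"
      using step(1) by (cases k) (auto simp: field_simps)
    also have "(2 - (real k + 2) / 2 ^ k) + Suc k / 2 ^ Suc k = 2 - (real (Suc k) + 2) / (2 :: real) ^ Suc k"
      by (simp add: field_simps)
    also have "A * (t k - t 1) + A * h = A * (t (Suc k) - t 1)"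
      by (simp add: h_def algebra_simps)
    also have "L * S k + L * (h * E (Suc k)) = L * S (Suc k)"
      using step(1) by (simp add: S_def h_def algebra_simps)
    finally show ?case .
  qed
  \<comment> \<open>The estimate is applied at the index \<open>j\<close> where the maximum is
    attained. The partial sums are then replaced by their limits 1 and 2, and the other terms
    increase with the index.\<close>
  have Eb: "E n \<le> D + A * (t n - t 1) + L * S n" if n: "1 \<le> n" "n \<le> N" for n
  proof -
    obtain j where j: "1 \<le> j" "j \<le> n" "E n = \<bar>e j\<bar>" using E_attained[OF n(1)] by auto
    have "E n \<le> \<bar>e 1\<bar> + \<tau> * \<bar>x 1\<bar> * (1 - 1 / 2 ^ (j - 1)) + \<tau> * B * (2 - (real j + 2) / 2 ^ j)
      + A * (t j - t 1) + L * S j"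
      using eb[of j] j n by simp
    also have "\<dots> \<le> \<bar>e 1\<bar> + \<tau> * \<bar>x 1\<bar> * 1 + \<tau> * B * 2 + A * (t n - t 1) + L * S n"
      using j n A B L \<tau> t_mono[of j n] mesh E0
      by (intro add_mono mult_left_mono order_refl) (auto simp: S_def intro!: sum_mono2)
    finally show ?thesis by (simp add: D_def algebra_simps)
  qed
  have "E n \<le> exp (2 * L * (t n - t 1)) * (D + A * (t n - t 1))"
  proof (rule implicit_gronwall[OF L A _ _ _ n])
    show "D \<ge> 0" using \<tau> B by (simp add: D_def)
    show "t k \<le> t (Suc k) \<and> L * (t (Suc k) - t k) \<le> 1 / 4" if "1 \<le> k" "k < N" for k
      using mesh[OF that] L L\<tau> mult_left_mono[of "t (Suc k) - t k" \<tau> L] by linarith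
  qed (use Eb in \<open>auto simp: S_def\<close>)
  then have EW: "E n \<le> W" by (simp add: W_def D_def)
  then show "\<bar>e n\<bar> \<le> W" using eE[of n n] n by simp
  show "\<bar>x n\<bar> \<le> \<bar>x 1\<bar> / 2 ^ (n - 1) + L * W + A + B * n / 2 ^ n"
    using xb[OF n] mult_left_mono[OF EW L] by linarith
qed

section \<open>The BDF2 operator, the correction and the kernels\<close>

lemma BDF2_two_terms:
  assumes "n \<ge> 2"
  shows "BDF2 t w n = (1 + 2 * ratio t n) / (1 + ratio t n) * dq t w n
    - ratio t n / (1 + ratio t n) * dq t w (n - 1)"
proof -
  obtain m where n: "n = Suc (Suc m)" using assms by (metis add_2_eq_Suc le_Suc_ex)
  have "(\<Sum>j=1..m. bdf2_kernel t n (n - j) * dq t w j) = 0"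
    by (intro sum.neutral) (auto simp: bdf2_kernel_def n)
  then show ?thesis by (simp add: BDF2_def n bdf2_kernel_def)
qed

text \<open>This is division by the leading kernel: with \<open>r\<close> for the step ratio, the
  quotient of the two kernels is \<open>- \<rho>\<close>, and the reciprocal of the leading one is
  \<open>(1 + r) / (1 + 2 * r) = 1 - \<rho>\<close>.\<close>

lemma BDF2_eq_iff_convex_recursion:
  assumes "n \<ge> 2" "ratio t n > 0"
  defines "\<rho> \<equiv> ratio t n / (1 + 2 * ratio t n)"
  shows "BDF2 t w n = F \<longleftrightarrow> dq t w n = \<rho> * dq t w (n - 1) + (1 - \<rho>) * F"
proof -
  have "1 + ratio t n > 0" "1 + 2 * ratio t n > 0" using assms by auto
  then show ?thesis
    unfolding BDF2_two_terms[OF assms(1)] \<rho>_def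
    by (simp add: divide_simps) (auto simp: algebra_simps)
qed

text \<open>With \<open>p\<close> and \<open>q\<close> for the last two steps the bracket equals
  \<open>p * (p + q)\<close>, and \<open>p + q\<close> is the outer divisor of the divided
  difference, so no step ratio survives.\<close>

lemma DC23_eq_dq:
  assumes "n \<ge> 2" "step t n > 0" "step t (n - 1) > 0"
  shows "DC23 f t w n = step t n / 3 *
    (dq t (\<lambda>k. f (t k) (w k)) n - dq t (\<lambda>k. f (t k) (w k)) (n - 1))"
proof -
  obtain m where n: "n = Suc (Suc m)" using assms by (metis add_2_eq_Suc le_Suc_ex)
  define p q where "p = step t n" and "q = step t (n - 1)"
  have pq: "p > 0" "q > 0" using assms by (auto simp: p_def q_def)
  have 1: "t n - t (n - 1) = p" "t (n - 1) - t (n - 2) = q" "t n - t (n - 2) = p + q"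
    by (auto simp: p_def q_def step_def n)
  have 2: "p / q * (p + q)\<^sup>2 - (1 + p / q) * p\<^sup>2 = p * (p + q)"
    using pq by (simp add: field_simps power2_eq_square)
  have 3: "n - 1 - 1 = n - 2" by simp
  have 4: "1 / 3 * (p * (p + q)) * (X / (p + q)) = p / 3 * X" for X
    using pq by (simp add: divide_simps)
  show ?thesis
    unfolding DC23_def divdiff3_def dq_def ratio_def 1 3 p_def[symmetric] q_def[symmetric] 2 4 ..
qed

text \<open>The recursion carries a minus sign and the off-diagonal BDF2 kernels are at most 0, so
  nonnegativity passes on from smaller lower indices. The condition \<open>k + 2 \<le> n\<close>
  keeps \<open>n - k\<close> at least 2, where the ratios are controlled.\<close>

lemma doc_kernel_nonneg:
  assumes pos: "\<And>i. 2 \<le> i \<Longrightarrow> i \<le> n \<Longrightarrow> ratio t i \<ge> 0"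
  shows "k + 2 \<le> n \<Longrightarrow> doc_kernel t n k \<ge> 0"
proof (induction k rule: less_induct)
  case (less k)
  have b0: "bdf2_kernel t i 0 \<ge> 0" if "2 \<le> i" "i \<le> n" for i
    using pos[OF that] by (simp add: bdf2_kernel_def)
  show ?case
  proof (cases "k = 0")
    case True
    then show ?thesis using b0[of n] less by (simp add: doc_kernel.simps)
  next
    case False
    have "doc_kernel t n (n - i) * bdf2_kernel t i (i - (n - k)) \<le> 0" if "i \<in> {n - k + 1..n}" for i
      using that less pos[of i] False by (intro mult_nonneg_nonpos less) (auto simp: bdf2_kernel_def)
    then have "(\<Sum>i=n-k+1..n. doc_kernel t n (n - i) * bdf2_kernel t i (i - (n - k))) \<le> 0"
      by (intro sum_nonpos) auto
    moreover have "doc_kernel t n k = - (1 / bdf2_kernel t (n - k) 0) *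
        (\<Sum>i=n-k+1..n. doc_kernel t n (n - i) * bdf2_kernel t i (i - (n - k)))"
      using False by (subst doc_kernel.simps) (simp add: Let_def)
    ultimately show ?thesis
      using b0[of "n - k"] less(2) by (auto intro!: divide_nonpos_nonneg)
  qed
qed

lemma sigma3_nonneg:
  assumes "\<And>i. 2 \<le> i \<Longrightarrow> i \<le> n \<Longrightarrow> ratio t i \<ge> 0"
  shows "sigma3 t n \<ge> 0"
  unfolding sigma3_def sigma2_def
  using assms by (intro sum_nonneg mult_nonneg_nonneg doc_kernel_nonneg prod_nonneg) auto

section \<open>Regularity and truncation\<close>

lemma mean_value_quotient:
  fixes g :: "real \<Rightarrow> real"
  assumes "a < b" "continuous_on {a..b} g"
    and "\<And>s. a < s \<Longrightarrow> s < b \<Longrightarrow> (g has_real_derivative g' s) (at s)"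
  obtains \<xi> where "a < \<xi>" "\<xi> < b" "(g b - g a) / (b - a) = g' \<xi>"
proof -
  obtain \<xi> where "\<xi> \<in> {a<..<b}" "g b - g a = (b - a) * g' \<xi>"
    using mvt[of a b g "\<lambda>s. (*) (g' s)"] assms
    by (metis greaterThanLessThan_iff has_field_derivative_def mult.commute)
  then show ?thesis using that[of \<xi>] assms(1) by auto
qed

text \<open>This is the mean value inequality on \<open>{s..a}\<close>, where the bound for the
  derivative is largest at \<open>s\<close>. Each use gains one power of the distance to
  \<open>a\<close> and forgoes the factor \<open>1 / (m + 1)\<close> of exact integration.\<close>

lemma vanishing_at_end_bound:
  fixes g :: "real \<Rightarrow> real"
  assumes der: "\<And>s. s \<in> {0<..T} \<Longrightarrow> (g has_real_derivative g' s) (at s within {0<..T})"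
    and bound: "\<And>s. 0 < s \<Longrightarrow> s \<le> a \<Longrightarrow> \<bar>g' s\<bar> \<le> K * (a - s) ^ m"
    and "g a = 0" "a \<le> T" "0 < s" "s \<le> a" "K \<ge> 0"
  shows "\<bar>g s\<bar> \<le> K * (a - s) ^ Suc m"
proof -
  have "norm (g s - g a) \<le> K * (a - s) ^ m * norm (s - a)"
  proof (rule field_differentiable_bound[where S = "{s..a}"])
    fix u assume u: "u \<in> {s..a}"
    then show "(g has_real_derivative g' u) (at u within {s..a})"
      using assms by (intro DERIV_subset[OF der[of u]]) auto
    have "K * (a - u) ^ m \<le> K * (a - s) ^ m"
      using u assms by (intro mult_left_mono power_mono) auto
    then show "norm (g' u) \<le> K * (a - s) ^ m"
      using order_trans[OF bound[of u]] u assms by simp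
  qed (use assms in auto)
  then show ?thesis using assms by (simp add: mult_ac)
qed

text \<open>Here \<open>v2\<close> and \<open>v3\<close> are the second and third derivatives of
  \<open>v\<close>, and \<open>a\<close>, \<open>b\<close>, \<open>c\<close> stand for
  \<open>t n\<close>, \<open>t (n - 1)\<close>, \<open>t (n - 2)\<close>. Derivatives are given only
  on \<open>{0<..T}\<close>, so \<open>c = 0\<close> is reached through the continuity of
  \<open>v\<close> and \<open>F\<close>.\<close>

lemma bdf2_truncation_bounds:
  fixes v F v2 v3 :: "real \<Rightarrow> real"
  assumes cont: "continuous_on {0..T} v" "continuous_on {0..T} F"
    and v: "\<And>s. s \<in> {0<..T} \<Longrightarrow> (v has_real_derivative F s) (at s within {0<..T})"
    and F: "\<And>s. s \<in> {0<..T} \<Longrightarrow> (F has_real_derivative v2 s) (at s within {0<..T})"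
    and v2: "\<And>s. s \<in> {0<..T} \<Longrightarrow> (v2 has_real_derivative v3 s) (at s within {0<..T})"
    and v3: "\<And>s u. s \<in> {0<..T} \<Longrightarrow> u \<in> {0<..T} \<Longrightarrow> \<bar>v3 s - v3 u\<bar> \<le> K * \<bar>s - u\<bar>"
    and v3_bound: "\<And>s. s \<in> {0<..T} \<Longrightarrow> \<bar>v3 s\<bar> \<le> K3"
    and K: "K \<ge> 0"
    and abc: "0 \<le> c" "c < b" "b < a" "a \<le> T"
  defines "p \<equiv> a - b" and "q \<equiv> b - c"
  defines "D \<equiv> (q + 2 * p) / (p + q) * ((v a - v b) / p) - p / (p + q) * ((v b - v c) / q)"
    and "Q \<equiv> p / 3 * ((F a - F b) / p - (F b - F c) / q)"
  shows "\<bar>D + Q - F a\<bar> \<le> 4 * K * (p + q) ^ 3" and "\<bar>Q\<bar> \<le> K3 * (p + q)\<^sup>2"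
proof -
  have pq: "p > 0" "q > 0" and sa: "b - a = - p" "c - a = - (p + q)"
    using abc by (auto simp: p_def q_def)
  have a: "a \<in> {0<..T}" using abc by auto
  have at: "at s within {0<..T} = at s" if "0 < s" "s < T" for s
    by (rule at_within_open_subset[of _ "{0<..<T}"]) (use that in auto)
  have sub: "{c..b} \<subseteq> {0..T}" "{b..a} \<subseteq> {0..T}" using abc by auto
  define g2 g3 where "g2 = v2 a / 2" and "g3 = v3 a / 6"
  text \<open>
    \<open>R0\<close> is the remainder of the cubic Taylor polynomial at \<open>a\<close>.  BDF2 with correction is exact for
    cubic polynomials.  The remainder enters only through mean values of \<open>R1\<close> and \<open>R2\<close>, because
    dividing a bound for \<open>R0\<close> by \<open>q\<close> would bring back the step ratio.
  \<close>
  define R2 where "R2 s = v2 s - 2 * g2 - 6 * g3 * (s - a)" for s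
  define R1 where "R1 s = F s - F a - 2 * g2 * (s - a) - 3 * g3 * (s - a)\<^sup>2" for s
  define R0 where "R0 s = v s - v a - F a * (s - a) - g2 * (s - a)\<^sup>2 - g3 * (s - a) ^ 3" for s
  have R2': "(R2 has_real_derivative v3 s - 6 * g3) (at s within {0<..T})" if "s \<in> {0<..T}" for s
    unfolding R2_def by (auto intro!: derivative_eq_intros v2 that)
  have R1': "(R1 has_real_derivative R2 s) (at s within {0<..T})" if "s \<in> {0<..T}" for s
    unfolding R1_def R2_def by (auto intro!: derivative_eq_intros F that)
  have R0': "(R0 has_real_derivative R1 s) (at s within {0<..T})" if "s \<in> {0<..T}" for s
    unfolding R0_def R1_def by (auto intro!: derivative_eq_intros v that)
  have R2: "\<bar>R2 s\<bar> \<le> K * (a - s) ^ Suc 1" if "0 < s" "s \<le> a" for s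
  proof (rule vanishing_at_end_bound[OF R2'])
    show "\<bar>v3 u - 6 * g3\<bar> \<le> K * (a - u) ^ 1" if "0 < u" "u \<le> a" for u
      using v3[of u a] that a by (simp add: g3_def)
  qed (use that abc K in \<open>auto simp: R2_def g2_def\<close>)
  have R1: "\<bar>R1 s\<bar> \<le> K * (a - s) ^ Suc (Suc 1)" if "0 < s" "s \<le> a" for s
    using R1' by (rule vanishing_at_end_bound) (use that abc K R2 in \<open>auto simp: R1_def\<close>)
  have R1_cont: "continuous_on {0..T} R1" and R0_cont: "continuous_on {0..T} R0"
    unfolding R1_def R0_def by (intro continuous_intros cont; simp)+
  \<comment> \<open>Intermediate points lie strictly between the nodes. They are positive even if
    \<open>c = 0\<close>, so the bounds for \<open>R1\<close> and \<open>R2\<close> apply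
    there.\<close>
  have R_quot: "\<bar>(R0 y - R0 x) / (y - x)\<bar> \<le> K * (p + q) ^ 3" "\<bar>(R1 y - R1 x) / (y - x)\<bar> \<le> K * (p + q)\<^sup>2"
    if "c \<le> x" "x < y" "y \<le> a" for x y
  proof -
    have sub: "{x..y} \<subseteq> {0..T}" using that abc by auto
    have in_range: "0 < s" "s < T" "s \<in> {0<..T}" "s \<le> a" "a - s \<le> p + q" "0 \<le> a - s" if "x < s" "s < y" for s
      using that \<open>c \<le> x\<close> \<open>y \<le> a\<close> abc by (auto simp: p_def q_def)
    obtain \<xi> where \<xi>: "x < \<xi>" "\<xi> < y" "(R0 y - R0 x) / (y - x) = R1 \<xi>"
      using mean_value_quotient[OF \<open>x < y\<close> continuous_on_subset[OF R0_cont sub], of R1] R0' in_range at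
      by metis
    have "K * (a - \<xi>) ^ 3 \<le> K * (p + q) ^ 3"
      using in_range[OF \<xi>(1,2)] K by (intro mult_left_mono power_mono) auto
    then show "\<bar>(R0 y - R0 x) / (y - x)\<bar> \<le> K * (p + q) ^ 3"
      using R1[of \<xi>] in_range[OF \<xi>(1,2)] unfolding \<xi>(3) by (simp add: numeral_3_eq_3)
    obtain \<eta> where \<eta>: "x < \<eta>" "\<eta> < y" "(R1 y - R1 x) / (y - x) = R2 \<eta>"
      using mean_value_quotient[OF \<open>x < y\<close> continuous_on_subset[OF R1_cont sub], of R2] R1' in_range at
      by metis
    have "K * (a - \<eta>)\<^sup>2 \<le> K * (p + q)\<^sup>2"
      using in_range[OF \<eta>(1,2)] K by (intro mult_left_mono power_mono) auto
    then show "\<bar>(R1 y - R1 x) / (y - x)\<bar> \<le> K * (p + q)\<^sup>2"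
      using R2[of \<eta>] in_range[OF \<eta>(1,2)] unfolding \<eta>(3) by (simp add: numeral_2_eq_2)
  qed
  define x1 x0 y1 y0 where "x1 = (R0 a - R0 b) / p" and "x0 = (R0 b - R0 c) / q"
    and "y1 = (R1 a - R1 b) / p" and "y0 = (R1 b - R1 c) / q"
  have x: "\<bar>x1\<bar> \<le> K * (p + q) ^ 3" "\<bar>x0\<bar> \<le> K * (p + q) ^ 3"
    and y: "\<bar>y1\<bar> \<le> K * (p + q)\<^sup>2" "\<bar>y0\<bar> \<le> K * (p + q)\<^sup>2"
    using R_quot[of b a] R_quot[of c b] abc by (auto simp: x1_def x0_def y1_def y0_def p_def q_def)
  \<comment> \<open>This is \<open>r / (1 + r)\<close> for the ratio \<open>r = p / q\<close>. It
    stays between 0 and 1, and the identities \<open>\<beta>1\<close> and \<open>\<beta>2\<close>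
    clear its denominator before the cubic parts are compared.\<close>
  define \<beta> where "\<beta> = p / (p + q)"
  have \<beta>: "\<beta> * (p + q) = p" and \<alpha>: "(q + 2 * p) / (p + q) = 1 + \<beta>"
    using pq by (simp_all add: \<beta>_def field_simps)
  have \<beta>01: "0 \<le> \<beta>" "\<beta> \<le> 1"
    using pq by (simp_all add: \<beta>_def)
  have \<beta>1: "\<beta> * (2 * p + q) = p + \<beta> * p"
    using \<beta> by (simp add: ring_distribs)
  have \<beta>2: "\<beta> * (3 * p\<^sup>2 + 3 * p * q + q\<^sup>2) = p * (2 * p + q) + \<beta> * p\<^sup>2"
  proof -
    have "\<beta> * (3 * p\<^sup>2 + 3 * p * q + q\<^sup>2) = \<beta> * (p + q) * (2 * p + q) + \<beta> * p\<^sup>2"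
      by (simp add: algebra_simps power2_eq_square)
    then show ?thesis unfolding \<beta> .
  qed
  have R0b: "R0 b = v b - v a + F a * p - g2 * p\<^sup>2 + g3 * p ^ 3"
    and R0c: "R0 c = v c - v a + F a * (p + q) - g2 * (p + q)\<^sup>2 + g3 * (p + q) ^ 3"
    and R1b: "R1 b = F b - F a + 2 * g2 * p - 3 * g3 * p\<^sup>2"
    and R1c: "R1 c = F c - F a + 2 * g2 * (p + q) - 3 * g3 * (p + q)\<^sup>2"
    and Ra: "R0 a = 0" "R1 a = 0"
    unfolding R0_def R1_def sa by (simp_all add: algebra_simps power2_eq_square power3_eq_cube)
  have "v a - v b = p * (F a - g2 * p + g3 * p\<^sup>2) + (R0 a - R0 b)"
    unfolding R0b Ra by (simp add: algebra_simps power2_eq_square power3_eq_cube)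
  then have vab: "(v a - v b) / p = F a - g2 * p + g3 * p\<^sup>2 + x1"
    using pq by (simp add: x1_def add_divide_distrib)
  have "v b - v c = q * (F a - g2 * (2 * p + q) + g3 * (3 * p\<^sup>2 + 3 * p * q + q\<^sup>2)) + (R0 b - R0 c)"
    unfolding R0b R0c by (simp add: algebra_simps power2_eq_square power3_eq_cube)
  then have vbc: "(v b - v c) / q =
      F a - g2 * (2 * p + q) + g3 * (3 * p\<^sup>2 + 3 * p * q + q\<^sup>2) + x0"
    using pq by (simp add: x0_def add_divide_distrib)
  have "F a - F b = p * (2 * g2 - 3 * g3 * p) + (R1 a - R1 b)"
    unfolding R1b Ra by (simp add: algebra_simps power2_eq_square)
  then have Fab: "(F a - F b) / p = 2 * g2 - 3 * g3 * p + y1"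
    using pq by (simp add: y1_def add_divide_distrib)
  have "F b - F c = q * (2 * g2 - 3 * g3 * (2 * p + q)) + (R1 b - R1 c)"
    unfolding R1b R1c by (simp add: algebra_simps power2_eq_square)
  then have Fbc: "(F b - F c) / q = 2 * g2 - 3 * g3 * (2 * p + q) + y0"
    using pq by (simp add: y0_def add_divide_distrib)
  have vbc': "\<beta> * ((v b - v c) / q) = \<beta> * F a - g2 * (\<beta> * (2 * p + q))
      + g3 * (\<beta> * (3 * p\<^sup>2 + 3 * p * q + q\<^sup>2)) + \<beta> * x0"
    unfolding vbc by (simp add: ring_distribs mult_ac)
  have Fabc: "p / 3 * (2 * g2 - 3 * g3 * p + y1 - (2 * g2 - 3 * g3 * (2 * p + q) + y0))
      = g3 * p * (p + q) + p / 3 * (y1 - y0)"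
    by (simp add: algebra_simps diff_divide_distrib)
  have "D + Q - F a = (1 + \<beta>) * (F a - g2 * p + g3 * p\<^sup>2 + x1)
      - (\<beta> * F a - g2 * (p + \<beta> * p) + g3 * (p * (2 * p + q) + \<beta> * p\<^sup>2) + \<beta> * x0)
      + (g3 * p * (p + q) + p / 3 * (y1 - y0)) - F a"
    unfolding D_def Q_def \<beta>_def[symmetric] \<alpha> vab vbc' Fab Fbc Fabc \<beta>1 \<beta>2 ..
  \<comment> \<open>Exactness on cubics: the coefficients of \<open>F a\<close>, \<open>g2\<close>
    and \<open>g3\<close> cancel, and only quotients of remainders are left.\<close>
  also have "\<dots> = (1 + \<beta>) * x1 - \<beta> * x0 + p / 3 * (y1 - y0)"
    by (simp add: ring_distribs power2_eq_square mult_ac)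
  finally have "D + Q - F a = (1 + \<beta>) * x1 - \<beta> * x0 + p / 3 * (y1 - y0)" .
  then have "\<bar>D + Q - F a\<bar> = \<bar>(1 + \<beta>) * x1 - \<beta> * x0 + p / 3 * (y1 - y0)\<bar>" by (rule arg_cong)
  also have "\<dots> \<le> (1 + \<beta>) * \<bar>x1\<bar> + \<beta> * \<bar>x0\<bar> + p / 3 * (\<bar>y1\<bar> + \<bar>y0\<bar>)"
  proof -
    have "\<bar>(1 + \<beta>) * x1\<bar> = (1 + \<beta>) * \<bar>x1\<bar>" "\<bar>\<beta> * x0\<bar> = \<beta> * \<bar>x0\<bar>"
      using \<beta>01 by (simp_all add: abs_mult)
    moreover have "\<bar>p / 3 * (y1 - y0)\<bar> \<le> p / 3 * (\<bar>y1\<bar> + \<bar>y0\<bar>)"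
      using pq by (simp add: abs_mult)
    ultimately show ?thesis by linarith
  qed
  also have "\<dots> \<le> 2 * (K * (p + q) ^ 3) + 1 * (K * (p + q) ^ 3) + (p + q) / 3 * (K * (p + q)\<^sup>2 + K * (p + q)\<^sup>2)"
    using pq \<beta>01 x y K by (intro add_mono mult_mono) auto
  also have "(p + q) / 3 * (K * (p + q)\<^sup>2 + K * (p + q)\<^sup>2) = 2 / 3 * (K * (p + q) ^ 3)"
    by (simp add: power2_eq_square power3_eq_cube)
  also have "2 * (K * (p + q) ^ 3) + 1 * (K * (p + q) ^ 3) + 2 / 3 * (K * (p + q) ^ 3) \<le> 4 * (K * (p + q) ^ 3)"
    using K pq by simp
  finally show "\<bar>D + Q - F a\<bar> \<le> 4 * K * (p + q) ^ 3" by simp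
  \<comment> \<open>Both quotients of \<open>F\<close> are values of \<open>v2\<close> at points
    less than \<open>p + q\<close> apart, so the bound on \<open>v3\<close> supplies the second
    power.\<close>
  obtain \<xi> where \<xi>: "b < \<xi>" "\<xi> < a" "(F a - F b) / p = v2 \<xi>"
    using mean_value_quotient[OF \<open>b < a\<close> continuous_on_subset[OF cont(2) sub(2)], of v2] F at abc
    unfolding p_def by (smt (verit) greaterThanAtMost_iff)
  obtain \<eta> where \<eta>: "c < \<eta>" "\<eta> < b" "(F b - F c) / q = v2 \<eta>"
    using mean_value_quotient[OF \<open>c < b\<close> continuous_on_subset[OF cont(2) sub(1)], of v2] F at abc
    unfolding q_def by (smt (verit) greaterThanAtMost_iff)
  have "norm (v2 \<xi> - v2 \<eta>) \<le> K3 * norm (\<xi> - \<eta>)"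
  proof (rule field_differentiable_bound[where S = "{0<..T}" and f' = v3])
    show "convex {0<..T}" by (rule convex_real_interval)
  qed (use v2 v3_bound \<xi> \<eta> abc in auto)
  also have "\<dots> \<le> K3 * (p + q)"
    using \<xi> \<eta> v3_bound[OF a] by (intro mult_left_mono) (auto simp: p_def q_def)
  finally have d: "\<bar>v2 \<xi> - v2 \<eta>\<bar> \<le> K3 * (p + q)" by simp
  have "\<bar>Q\<bar> = p / 3 * \<bar>v2 \<xi> - v2 \<eta>\<bar>"
    using pq by (simp add: Q_def \<xi> \<eta> abs_mult)
  also have "\<dots> \<le> (p + q) * (K3 * (p + q))"
    using pq d by (intro mult_mono) auto
  finally show "\<bar>Q\<bar> \<le> K3 * (p + q)\<^sup>2" by (simp add: power2_eq_square mult_ac)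
qed

section \<open>Smoothness classes in one and two variables\<close>

lemma Ck_on_Suc_real:
  fixes g :: "real \<Rightarrow> real"
  assumes "Ck_on (Suc k) S g"
  obtains g' where "\<And>s. s \<in> S \<Longrightarrow> (g has_real_derivative g' s) (at s within S)" "Ck_on k S g'"
  using assms by (auto simp: has_field_derivative_def mult_commute_abs)

lemma Ck_on_Suc_prod:
  fixes g :: "real \<times> real \<Rightarrow> real"
  assumes "Ck_on (Suc k) S g"
  obtains gx gy where
    "\<And>p. p \<in> S \<Longrightarrow> (g has_derivative (\<lambda>h. fst h * gx p + snd h * gy p)) (at p within S)"
    "Ck_on k S gx" "Ck_on k S gy"
proof -
  obtain G where G: "\<And>p. p \<in> S \<Longrightarrow> (g has_derivative (\<lambda>h. \<Sum>b\<in>Basis. (h \<bullet> b) * G b p)) (at p within S)"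
    "\<And>b. b \<in> Basis \<Longrightarrow> Ck_on k S (G b)"
    using assms by auto
  have B: "(Basis :: (real \<times> real) set) = {(1, 0), (0, 1)}"
    by (auto simp: Basis_prod_def)
  show ?thesis
    using that[of "G (1, 0)" "G (0, 1)"] G by (simp add: B inner_prod_def)
qed

lemma Ck_on_imp_continuous_on:
  "Ck_on k S g \<Longrightarrow> continuous_on S g"
  by (cases k) (auto intro: has_derivative_continuous_on)

text \<open>At \<open>s = 0\<close> or \<open>s = T\<close> the derivative is one-sided in the first
  argument, but the line of all \<open>(s, y)\<close> lies in the strip, so in \<open>y\<close> it
  is two-sided.\<close>

lemma has_real_derivative_snd_argument:
  fixes g :: "real \<times> real \<Rightarrow> real"
  assumes "(g has_derivative (\<lambda>h. fst h * gx + snd h * gy)) (at (s, y) within {0..T} \<times> UNIV)" "s \<in> {0..T}"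
  shows "((\<lambda>y. g (s, y)) has_real_derivative gy) (at y)"
proof -
  have "((\<lambda>y. g (s, y)) has_derivative (\<lambda>h. fst (0 :: real, h) * gx + snd (0 :: real, h) * gy)) (at y within UNIV)"
  proof (rule has_derivative_in_compose[where f = "\<lambda>y. (s, y)" and f' = "\<lambda>h. (0, h)", THEN has_derivative_eq_rhs])
    show "((\<lambda>y. (s, y)) has_derivative (\<lambda>h. (0, h))) (at y within UNIV)"
      by (auto intro!: derivative_eq_intros)
    show "(g has_derivative (\<lambda>h. fst h * gx + snd h * gy)) (at (s, y) within range (\<lambda>y. (s, y)))"
      using assms by (auto intro: has_derivative_subset)
  qed auto
  then show ?thesis by (simp add: has_field_derivative_def mult_commute_abs)
qed

text \<open>The partial derivative in the second argument is continuous, hence bounded on a compact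
  rectangle. The strip itself is not compact, so the constant depends on \<open>Y\<close>.\<close>

lemma C1_lipschitz_snd:
  fixes g :: "real \<times> real \<Rightarrow> real"
  assumes "Ck_on (Suc k) ({0..T} \<times> UNIV) g"
  obtains K where "K \<ge> 0" "\<And>s y y'. s \<in> {0..T} \<Longrightarrow> \<bar>y\<bar> \<le> Y \<Longrightarrow> \<bar>y'\<bar> \<le> Y \<Longrightarrow>
    \<bar>g (s, y) - g (s, y')\<bar> \<le> K * \<bar>y - y'\<bar>"
proof -
  obtain gx gy where g: "\<And>p. p \<in> {0..T} \<times> UNIV \<Longrightarrow>
      (g has_derivative (\<lambda>h. fst h * gx p + snd h * gy p)) (at p within {0..T} \<times> UNIV)"
    and gy: "Ck_on k ({0..T} \<times> UNIV) gy"
    by (rule Ck_on_Suc_prod[OF assms]) blast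
  have "compact (gy ` ({0..T} \<times> {-Y..Y}))"
    by (intro compact_continuous_image compact_Times continuous_on_subset[OF Ck_on_imp_continuous_on[OF gy]]) auto
  then obtain K where "\<forall>z\<in>gy ` ({0..T} \<times> {-Y..Y}). norm z \<le> K"
    using compact_imp_bounded bounded_iff by blast
  then have K: "\<bar>gy p\<bar> \<le> K" if "p \<in> {0..T} \<times> {-Y..Y}" for p
    using that by auto
  have "\<bar>g (s, y) - g (s, y')\<bar> \<le> max 0 K * \<bar>y - y'\<bar>"
    if "s \<in> {0..T}" "\<bar>y\<bar> \<le> Y" "\<bar>y'\<bar> \<le> Y" for s y y'
  proof -
    have "norm (g (s, y) - g (s, y')) \<le> max 0 K * norm (y - y')"
    proof (rule field_differentiable_bound[where S = "{-Y..Y}" and f' = "\<lambda>y. gy (s, y)"])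
      fix z assume z: "z \<in> {-Y..Y}"
      then show "norm (gy (s, z)) \<le> max 0 K" using K[of "(s, z)"] that by auto
      show "((\<lambda>y. g (s, y)) has_real_derivative gy (s, z)) (at z within {-Y..Y})"
        using has_real_derivative_snd_argument[OF g[of "(s, z)"]] that by (auto intro: has_field_derivative_at_within)
    qed (use that in auto)
    then show ?thesis by simp
  qed
  then show ?thesis using that[of "max 0 K"] by auto
qed

text \<open>With the error \<open>e\<close> frozen, the derivative of
  \<open>f u (v u) - f u (v u - e)\<close> in \<open>u\<close> consists of differences of first
  partial derivatives at arguments \<open>e\<close> apart, which are of order
  \<open>\<bar>e\<bar>\<close> as \<open>f\<close> is twice continuously differentiable. The bound
  \<open>R\<close> keeps the arguments in a compact set, so \<open>K\<close> does not depend on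
  \<open>e\<close>.\<close>

lemma increment_of_error:
  fixes f :: "real \<Rightarrow> real \<Rightarrow> real" and v F :: "real \<Rightarrow> real"
  assumes f: "Ck_on 2 ({0..T} \<times> UNIV) (\<lambda>(s, y). f s y)"
    and v: "continuous_on {0..T} v"
    and v': "\<And>s. s \<in> {0<..T} \<Longrightarrow> (v has_real_derivative F s) (at s within {0<..T})"
    and F: "continuous_on {0..T} F"
  obtains K where "K \<ge> 0" "\<And>s s' e. 0 \<le> s \<Longrightarrow> s < s' \<Longrightarrow> s' \<le> T \<Longrightarrow> \<bar>e\<bar> \<le> R \<Longrightarrow>
    \<bar>(f s' (v s') - f s' (v s' - e)) - (f s (v s) - f s (v s - e))\<bar> \<le> K * \<bar>e\<bar> * (s' - s)"
proof -
  let ?S = "{0..T} \<times> (UNIV :: real set)"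
  let ?f = "\<lambda>(s, y). f s y"
  have f2: "Ck_on (Suc (Suc 0)) ?S ?f" using f by (simp add: numeral_2_eq_2)
  obtain fx fy where fd: "\<And>p. p \<in> ?S \<Longrightarrow>
      (?f has_derivative (\<lambda>h. fst h * fx p + snd h * fy p)) (at p within ?S)"
    and fx: "Ck_on (Suc 0) ?S fx" and fy: "Ck_on (Suc 0) ?S fy"
    by (rule Ck_on_Suc_prod[OF f2]) blast
  have "bounded (v ` {0..T})" "bounded (F ` {0..T})"
    using v F by (auto intro!: compact_imp_bounded compact_continuous_image)
  then obtain V V' where V: "\<And>s. s \<in> {0..T} \<Longrightarrow> \<bar>v s\<bar> \<le> V" and V': "\<And>s. s \<in> {0..T} \<Longrightarrow> \<bar>F s\<bar> \<le> V'"
    unfolding bounded_iff by (metis imageI real_norm_def)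
  obtain K1 where K1: "K1 \<ge> 0" "\<And>s y y'. s \<in> {0..T} \<Longrightarrow> \<bar>y\<bar> \<le> V + R \<Longrightarrow> \<bar>y'\<bar> \<le> V + R \<Longrightarrow>
    \<bar>fx (s, y) - fx (s, y')\<bar> \<le> K1 * \<bar>y - y'\<bar>" by (rule C1_lipschitz_snd[OF fx, of "V + R"]) blast
  obtain K2 where K2: "K2 \<ge> 0" "\<And>s y y'. s \<in> {0..T} \<Longrightarrow> \<bar>y\<bar> \<le> V + R \<Longrightarrow> \<bar>y'\<bar> \<le> V + R \<Longrightarrow>
    \<bar>fy (s, y) - fy (s, y')\<bar> \<le> K2 * \<bar>y - y'\<bar>" by (rule C1_lipschitz_snd[OF fy, of "V + R"]) blast
  define K where "K = K1 + K2 * max 0 V'"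
  have K0: "K \<ge> 0" using K1(1) K2(1) by (simp add: K_def)
  have f_comp: "((\<lambda>s. f s (v s - e)) has_real_derivative fx (s, v s - e) + F s * fy (s, v s - e)) (at s)"
    if s: "0 < s" "s < T" for s e
  proof -
    have at: "at s within {0<..T} = at s"
      by (rule at_within_open_subset[of _ "{0<..<T}"]) (use s in auto)
    have "((\<lambda>u. ?f (u, v u - e)) has_derivative
        (\<lambda>h. fst (h, h * F s) * fx (s, v s - e) + snd (h, h * F s) * fy (s, v s - e))) (at s within {0<..T})"
    proof (rule has_derivative_in_compose[where f = "\<lambda>u. (u, v u - e)" and f' = "\<lambda>h. (h, h * F s)"])
      show "((\<lambda>u. (u, v u - e)) has_derivative (\<lambda>h. (h, h * F s))) (at s within {0<..T})"
        using v'[of s] s by (auto intro!: derivative_eq_intros simp: has_field_derivative_def mult_commute_abs)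
      show "(?f has_derivative (\<lambda>h. fst h * fx (s, v s - e) + snd h * fy (s, v s - e)))
          (at (s, v s - e) within (\<lambda>u. (u, v u - e)) ` {0<..T})"
        using s by (intro has_derivative_subset[OF fd]) auto
    qed
    then have "((\<lambda>u. f u (v u - e)) has_derivative
        (\<lambda>h. h * fx (s, v s - e) + h * F s * fy (s, v s - e))) (at s)"
      by (simp only: at split fst_conv snd_conv)
    then show ?thesis
      unfolding has_field_derivative_def
      by (rule has_derivative_eq_rhs) (simp add: fun_eq_iff algebra_simps)
  qed
  have f_cont: "continuous_on {0..T} (\<lambda>s. f s (v s - e))" for e
  proof -
    have "continuous_on {0..T} (\<lambda>s. (s, v s - e))" by (intro continuous_intros v)
    from continuous_on_compose2[OF Ck_on_imp_continuous_on[OF f] this] show ?thesis by auto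
  qed
  have "\<bar>(f s' (v s') - f s' (v s' - e)) - (f s (v s) - f s (v s - e))\<bar> \<le> K * \<bar>e\<bar> * (s' - s)"
    if s: "0 \<le> s" "s < s'" "s' \<le> T" and e: "\<bar>e\<bar> \<le> R" for s s' e
  proof -
    define \<phi> where "\<phi> u = f u (v u) - f u (v u - e)" for u
    define \<phi>' where "\<phi>' u = (fx (u, v u) - fx (u, v u - e)) + F u * (fy (u, v u) - fy (u, v u - e))" for u
    have "continuous_on {0..T} \<phi>"
      unfolding \<phi>_def using continuous_on_diff[OF f_cont[of 0] f_cont[of e]] by simp
    then have "continuous_on {s..s'} \<phi>" by (rule continuous_on_subset) (use s in auto)
    moreover have "(\<phi> has_real_derivative \<phi>' u) (at u)" if "s < u" "u < s'" for u
      unfolding \<phi>_def \<phi>'_def using DERIV_diff[OF f_comp[of u 0] f_comp[of u e]] that s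
      by (simp add: algebra_simps)
    ultimately obtain \<xi> where \<xi>: "s < \<xi>" "\<xi> < s'" "(\<phi> s' - \<phi> s) / (s' - s) = \<phi>' \<xi>"
      using mean_value_quotient[OF s(2)] by metis
    have \<xi>T: "\<xi> \<in> {0..T}" using \<xi> s by auto
    then have y: "\<bar>v \<xi>\<bar> \<le> V + R" "\<bar>v \<xi> - e\<bar> \<le> V + R" using V[OF \<xi>T] e by auto
    have "\<bar>\<phi>' \<xi>\<bar> \<le> \<bar>fx (\<xi>, v \<xi>) - fx (\<xi>, v \<xi> - e)\<bar> + \<bar>F \<xi>\<bar> * \<bar>fy (\<xi>, v \<xi>) - fy (\<xi>, v \<xi> - e)\<bar>"
      unfolding \<phi>'_def by (metis abs_mult abs_triangle_ineq)
    also have "\<dots> \<le> K1 * \<bar>e\<bar> + max 0 V' * (K2 * \<bar>e\<bar>)"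
      using K1(2)[OF \<xi>T y] K2(2)[OF \<xi>T y] V'[OF \<xi>T] by (intro add_mono mult_mono) auto
    also have "\<dots> = K * \<bar>e\<bar>" by (simp add: K_def algebra_simps)
    finally have "\<bar>\<phi>' \<xi>\<bar> * (s' - s) \<le> K * \<bar>e\<bar> * (s' - s)" using s by (intro mult_right_mono) auto
    moreover have "\<bar>\<phi> s' - \<phi> s\<bar> = \<bar>\<phi>' \<xi>\<bar> * (s' - s)"
    proof -
      have "\<phi> s' - \<phi> s = \<phi>' \<xi> * (s' - s)" using \<xi>(3) s by (simp add: divide_eq_eq)
      then show ?thesis using s by (simp add: abs_mult)
    qed
    ultimately show ?thesis by (simp add: \<phi>_def)
  qed
  then show ?thesis using that[of K] K0 by blast
qed

text \<open>It turns a bound on an iterated \<open>deriv\<close> into one on the last member of a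
  chain of derivatives. Openness of \<open>U\<close> lets the induction differentiate an equality
  that holds near \<open>s\<close>.\<close>

lemma deriv_funpow_eq_on_open:
  fixes v :: "real \<Rightarrow> real" and g :: "nat \<Rightarrow> real \<Rightarrow> real"
  assumes "open U" "\<And>k s. k < m \<Longrightarrow> s \<in> U \<Longrightarrow> (g k has_real_derivative g (Suc k) s) (at s)" "s \<in> U"
  shows "(deriv ^^ m) (g 0) s = g m s"
  using assms(2,3)
proof (induction m arbitrary: s)
  case (Suc m)
  have "((deriv ^^ m) (g 0) has_real_derivative g (Suc m) s) (at s)"
    using Suc by (intro has_field_derivative_transform_within_open[OF Suc.prems(1)[of m s] assms(1)]) auto
  then show ?case by (simp add: DERIV_imp_deriv)
qed simp

section \<open>Errors on a mesh\<close>

lemma BDF2_diff: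
  assumes "n \<ge> 2"
  shows "BDF2 t (\<lambda>k. a k - b k) n = BDF2 t a n - BDF2 t b n"
proof -
  have "dq t (\<lambda>k. a k - b k) k = dq t a k - dq t b k" for k
    by (simp add: dq_def diff_divide_distrib)
  then show ?thesis
    unfolding BDF2_two_terms[OF assms] by (simp add: right_diff_distrib)
qed

lemma is_mesh_facts:
  assumes "is_mesh T N t"
  shows step_pos: "1 \<le> k \<Longrightarrow> k \<le> N \<Longrightarrow> step t k > 0"
    and step_le_max_step: "1 \<le> k \<Longrightarrow> k \<le> N \<Longrightarrow> step t k \<le> max_step N t"
    and max_step_pos: "max_step N t > 0"
    and mesh_mono: "j \<le> k \<Longrightarrow> k \<le> N \<Longrightarrow> t j \<le> t k"
    and mesh_in_range: "k \<le> N \<Longrightarrow> t k \<in> {0..T}"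
proof -
  have pos: "step t k > 0" if "1 \<le> k" "k \<le> N" for k
    using assms that by (simp add: is_mesh_def step_def)
  have le: "step t k \<le> max_step N t" if "1 \<le> k" "k \<le> N" for k
    unfolding max_step_def using that by (intro Max_ge) auto
  have mono: "t j \<le> t k" if "j \<le> k" "k \<le> N" for j k
    using that
  proof (induction k rule: dec_induct)
    case (step i)
    then show ?case using pos[of "Suc i"] by (simp add: step_def)
  qed simp
  show "max_step N t > 0" using pos[of 1] le[of 1] assms by (simp add: is_mesh_def)
  show "k \<le> N \<Longrightarrow> t k \<in> {0..T}" using mono[of 0 k] mono[of k N] assms by (auto simp: is_mesh_def)
  show "1 \<le> k \<Longrightarrow> k \<le> N \<Longrightarrow> step t k > 0" "1 \<le> k \<Longrightarrow> k \<le> N \<Longrightarrow> step t k \<le> max_step N t"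
    "j \<le> k \<Longrightarrow> k \<le> N \<Longrightarrow> t j \<le> t k"
    by (fact pos le mono)+
qed

text \<open>This transfers \<open>convex_recursion_stability\<close> to meshes. The exponent is
  enlarged to contain \<open>T\<close>, so the exponential is known before the mesh is
  chosen.\<close>

lemma BDF2_stability:
  fixes e :: "nat \<Rightarrow> real"
  assumes mesh: "is_mesh T N t"
    and L: "L \<ge> 0" and A: "A \<ge> 0" and B: "B \<ge> 0" and L\<tau>: "L * max_step N t \<le> 1 / 4"
    and F: "\<And>k. 2 \<le> k \<Longrightarrow> k \<le> N \<Longrightarrow> \<bar>BDF2 t e k\<bar> \<le> L * \<bar>e k\<bar> + A + B / 2 ^ k"
    and n: "1 \<le> n" "n \<le> N"
  defines "W \<equiv> exp (2 * L * T) * (\<bar>e 1\<bar> + max_step N t * \<bar>dq t e 1\<bar> + 2 * max_step N t * B + A * t n)"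
  shows "\<bar>e n\<bar> \<le> W" and "\<bar>dq t e n\<bar> \<le> \<bar>dq t e 1\<bar> / 2 ^ (n - 1) + L * W + A + B * n / 2 ^ n"
proof -
  note m = is_mesh_facts[OF mesh]
  define \<rho> where "\<rho> k = ratio t k / (1 + 2 * ratio t k)" for k
  have ratio: "ratio t (Suc k) > 0" if "1 \<le> k" "k < N" for k
    using m(1)[of k] m(1)[of "Suc k"] that by (simp add: ratio_def)
  define W' where "W' = exp (2 * L * (t n - t 1)) *
    (\<bar>e 1\<bar> + max_step N t * \<bar>dq t e 1\<bar> + 2 * max_step N t * B + A * (t n - t 1))"
  have r1: "t k \<le> t (Suc k) \<and> t (Suc k) - t k \<le> max_step N t" if "1 \<le> k" "k < N" for k
    using m(2)[of "Suc k"] m(4)[of k "Suc k"] that by (simp add: step_def)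
  have r2: "0 \<le> \<rho> (Suc k) \<and> \<rho> (Suc k) \<le> 1 / 2" if "1 \<le> k" "k < N" for k
    using ratio[OF that] by (simp add: \<rho>_def divide_simps)
  have r3: "e (Suc k) = e k + (t (Suc k) - t k) * dq t e (Suc k)" if "1 \<le> k" "k < N" for k
    using m(1)[of "Suc k"] that by (simp add: dq_def step_def)
  have r4: "dq t e (Suc k) = \<rho> (Suc k) * dq t e k + (1 - \<rho> (Suc k)) * BDF2 t e (Suc k)"
    if "1 \<le> k" "k < N" for k
    using BDF2_eq_iff_convex_recursion[of "Suc k" t e "BDF2 t e (Suc k)"] ratio[OF that] that
    by (simp add: \<rho>_def)
  have r5: "\<bar>BDF2 t e (Suc k)\<bar> \<le> L * \<bar>e (Suc k)\<bar> + A + B / 2 ^ Suc k" if "1 \<le> k" "k < N" for k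
    using F[of "Suc k"] that by simp
  note st = convex_recursion_stability[of L A B "max_step N t" N t \<rho> e "dq t e" "BDF2 t e" n,
      OF L A B L\<tau> _ _ _ _ _ less_imp_le[OF m(3)] n, folded W'_def]
  have "\<bar>e n\<bar> \<le> W'" by (intro st(1) r1 r2 r3 r4 r5)
  moreover have "\<bar>dq t e n\<bar> \<le> \<bar>dq t e 1\<bar> / 2 ^ (n - 1) + L * W' + A + B * n / 2 ^ n"
    by (intro st(2) r1 r2 r3 r4 r5)
  moreover have W': "W' \<le> W"
    unfolding W'_def W_def
    using m(3) B A L m(5)[of n] m(5)[of 1] m(4)[of 1 n] n
    by (intro mult_mono add_mono order_refl) (auto intro!: mult_left_mono)
  ultimately show "\<bar>e n\<bar> \<le> W" "\<bar>dq t e n\<bar> \<le> \<bar>dq t e 1\<bar> / 2 ^ (n - 1) + L * W + A + B * n / 2 ^ n"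
    using mult_left_mono[OF W' L] by linarith+
qed

text \<open>The constants precede the mesh. A bounded fourth derivative makes the third one
  Lipschitz, hence bounded, on all of \<open>{0<..T}\<close>; smoothness on a set open at 0 would
  not give this.\<close>

lemma exact_solution_truncation:
  fixes v F :: "real \<Rightarrow> real"
  assumes T: "T > 0"
    and cont: "continuous_on {0..T} v" "continuous_on {0..T} F"
    and v: "\<And>s. s \<in> {0<..T} \<Longrightarrow> (v has_real_derivative F s) (at s within {0..T})"
    and C4: "Ck_on 4 {0<..T} v"
    and bounded: "bounded ((deriv ^^ 4) v ` {0<..<T})"
  obtains K K' where "K \<ge> 0" "K' \<ge> 0"
    "\<And>N t n. is_mesh T N t \<Longrightarrow> 2 \<le> n \<Longrightarrow> n \<le> N \<Longrightarrow>
      \<bar>BDF2 t (\<lambda>k. v (t k)) n + step t n / 3 * (dq t (\<lambda>k. F (t k)) n - dq t (\<lambda>k. F (t k)) (n - 1)) - F (t n)\<bar>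
        \<le> K * max_step N t ^ 3"
    "\<And>N t n. is_mesh T N t \<Longrightarrow> 2 \<le> n \<Longrightarrow> n \<le> N \<Longrightarrow>
      \<bar>step t n / 3 * (dq t (\<lambda>k. F (t k)) n - dq t (\<lambda>k. F (t k)) (n - 1))\<bar> \<le> K' * (max_step N t)\<^sup>2"
proof -
  let ?S = "{0<..T}"
  have "Ck_on (Suc (Suc (Suc (Suc 0)))) ?S v" using C4 by (simp add: eval_nat_numeral)
  then obtain v1 where v1: "\<And>s. s \<in> ?S \<Longrightarrow> (v has_real_derivative v1 s) (at s within ?S)"
    and c1: "Ck_on (Suc (Suc (Suc 0))) ?S v1" by (rule Ck_on_Suc_real) blast
  from c1 obtain v2 where v2: "\<And>s. s \<in> ?S \<Longrightarrow> (v1 has_real_derivative v2 s) (at s within ?S)"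
    and c2: "Ck_on (Suc (Suc 0)) ?S v2" by (rule Ck_on_Suc_real) blast
  from c2 obtain v3 where v3: "\<And>s. s \<in> ?S \<Longrightarrow> (v2 has_real_derivative v3 s) (at s within ?S)"
    and c3: "Ck_on (Suc 0) ?S v3" by (rule Ck_on_Suc_real) blast
  from c3 obtain v4 where v4: "\<And>s. s \<in> ?S \<Longrightarrow> (v3 has_real_derivative v4 s) (at s within ?S)"
    by (rule Ck_on_Suc_real) blast
  have at: "at s within ?S = at s" if "s \<in> {0<..<T}" for s
    by (rule at_within_open_subset[of _ "{0<..<T}"]) (use that in auto)
  have v4_eq: "(deriv ^^ 4) v s = v4 s" if s: "s \<in> {0<..<T}" for s
  proof -
    define g where "g = (\<lambda>k. [v, v1, v2, v3, v4] ! k)"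
    have "(g k has_real_derivative g (Suc k) s) (at s)" if "k < 4" "s \<in> {0<..<T}" for k s
    proof -
      have "k \<in> {0, 1, 2, 3}" using that by auto
      then show ?thesis
        using v1[of s] v2[of s] v3[of s] v4[of s] at[of s] that(2) by (auto simp: g_def numeral_3_eq_3)
    qed
    then have "(deriv ^^ 4) (g 0) s = g 4 s"
      using s by (intro deriv_funpow_eq_on_open[of "{0<..<T}"]) auto
    then show ?thesis by (simp add: g_def)
  qed
  obtain K4 where "\<forall>y\<in>(deriv ^^ 4) v ` {0<..<T}. norm y \<le> K4"
    using bounded bounded_iff by blast
  then have K4: "\<bar>v4 s\<bar> \<le> K4" if "s \<in> {0<..<T}" for s
    using that v4_eq[OF that] by force
  define K where "K = max 0 K4"
  have K: "K \<ge> 0" by (simp add: K_def)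
  \<comment> \<open>The bound on \<open>v4\<close> holds on the open interval only; at
    \<open>u = T\<close> continuity of \<open>v3\<close> is enough for the mean value
    theorem.\<close>
  have lip: "\<bar>v3 u - v3 s\<bar> \<le> K * \<bar>u - s\<bar>" if su: "0 < s" "s < u" "u \<le> T" for s u
  proof -
    have "continuous_on {s..u} v3"
      by (rule continuous_on_subset[OF Ck_on_imp_continuous_on[OF c3]]) (use su in auto)
    moreover have "(v3 has_real_derivative v4 x) (at x)" if "s < x" "x < u" for x
      using v4[of x] at[of x] that su by auto
    ultimately obtain \<xi> where \<xi>: "s < \<xi>" "\<xi> < u" "(v3 u - v3 s) / (u - s) = v4 \<xi>"
      using mean_value_quotient[OF su(2)] by metis
    have "v3 u - v3 s = v4 \<xi> * (u - s)" using \<xi>(3) su by (simp add: divide_eq_eq)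
    moreover have "\<bar>v4 \<xi>\<bar> \<le> K" using K4[of \<xi>] \<xi> su by (simp add: K_def)
    ultimately show ?thesis by (simp add: abs_mult mult_right_mono)
  qed
  have v3_lip: "\<bar>v3 s - v3 u\<bar> \<le> K * \<bar>s - u\<bar>" if "s \<in> ?S" "u \<in> ?S" for s u
    using lip[of s u] lip[of u s] that by (cases s u rule: linorder_cases) (auto simp: abs_minus_commute)
  define K3 where "K3 = \<bar>v3 T\<bar> + K * T"
  have K3: "\<bar>v3 s\<bar> \<le> K3" if "s \<in> ?S" for s
  proof -
    have "K * \<bar>s - T\<bar> \<le> K * T" using that K by (intro mult_left_mono) auto
    then show ?thesis using v3_lip[of s T] that T by (simp add: K3_def)
  qed
  have K30: "K3 \<ge> 0" using K T by (simp add: K3_def)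
  \<comment> \<open>The derivative from the smoothness class and the one from the differential
    equation agree, since no point of the interval is isolated. Thus \<open>F\<close> inherits the
    further derivatives of \<open>v1\<close>.\<close>
  have v1F: "v1 s = F s" if s: "s \<in> ?S" for s
  proof (rule vector_derivative_unique_within)
    show "at s within ?S \<noteq> bot"
      using s T by (auto simp: trivial_limit_within islimpt_Ioc)
    show "(v has_vector_derivative v1 s) (at s within ?S)"
      using v1[OF s] by (simp add: has_real_derivative_iff_has_vector_derivative)
    show "(v has_vector_derivative F s) (at s within ?S)"
      unfolding has_real_derivative_iff_has_vector_derivative[symmetric]
      by (rule DERIV_subset[OF v[OF s]]) auto
  qed
  have vF: "(v has_real_derivative F s) (at s within ?S)" if "s \<in> ?S" for s
    using v1[OF that] v1F[OF that] by simp
  have Fv2: "(F has_real_derivative v2 s) (at s within ?S)" if "s \<in> ?S" for s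
    by (rule has_field_derivative_transform_within[OF v2[OF that], of 1]) (use that v1F in auto)
  have main: "\<bar>BDF2 t (\<lambda>k. v (t k)) n + step t n / 3 * (dq t (\<lambda>k. F (t k)) n - dq t (\<lambda>k. F (t k)) (n - 1)) - F (t n)\<bar>
        \<le> 32 * K * max_step N t ^ 3 \<and>
      \<bar>step t n / 3 * (dq t (\<lambda>k. F (t k)) n - dq t (\<lambda>k. F (t k)) (n - 1))\<bar> \<le> 4 * K3 * (max_step N t)\<^sup>2"
    if mesh: "is_mesh T N t" and n: "2 \<le> n" "n \<le> N" for N t n
  proof -
    note m = is_mesh_facts[OF mesh]
    define p q where "p = step t n" and "q = step t (n - 1)"
    have nn: "n - 1 - 1 = n - 2" by simp
    have pq: "p > 0" "q > 0" "p \<le> max_step N t" "q \<le> max_step N t"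
      using m(1,2)[of n] m(1,2)[of "n - 1"] n by (auto simp: p_def q_def)
    have steps: "t n - t (n - 1) = p" "t (n - 1) - t (n - 2) = q"
      by (simp_all add: p_def q_def step_def numeral_2_eq_2)
    have order: "0 \<le> t (n - 2)" "t (n - 2) < t (n - 1)" "t (n - 1) < t n" "t n \<le> T"
      using steps pq m(5)[of n] m(5)[of "n - 2"] n by auto
    have r: "ratio t n = p / q" by (simp add: ratio_def p_def q_def)
    have w: "(1 + 2 * ratio t n) / (1 + ratio t n) = (q + 2 * p) / (p + q)"
      "ratio t n / (1 + ratio t n) = p / (p + q)"
      using pq unfolding r by (simp_all add: divide_simps add.commute)
    note trunc = bdf2_truncation_bounds[of T v F v2 v3 K K3, OF cont _ _ _ _ _ K order, unfolded steps]
    have b1: "\<bar>(q + 2 * p) / (p + q) * ((v (t n) - v (t (n - 1))) / p)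
        - p / (p + q) * ((v (t (n - 1)) - v (t (n - 2))) / q)
        + p / 3 * ((F (t n) - F (t (n - 1))) / p - (F (t (n - 1)) - F (t (n - 2))) / q) - F (t n)\<bar>
      \<le> 4 * K * (p + q) ^ 3"
      by (intro trunc(1) vF Fv2 v3 v3_lip K3)
    have b2: "\<bar>p / 3 * ((F (t n) - F (t (n - 1))) / p - (F (t (n - 1)) - F (t (n - 2))) / q)\<bar>
      \<le> K3 * (p + q)\<^sup>2"
      by (intro trunc(2) vF Fv2 v3 v3_lip K3)
    \<comment> \<open>Two consecutive steps add up to at most twice the maximal step, whence 32 = 4
      * 2^3 and 4 = 2^2.\<close>
    have "4 * K * (p + q) ^ 3 \<le> 4 * K * (2 * max_step N t) ^ 3"
      using pq K by (intro mult_left_mono power_mono) auto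
    moreover have "K3 * (p + q)\<^sup>2 \<le> K3 * (2 * max_step N t)\<^sup>2"
      using pq K30 by (intro mult_left_mono power_mono) auto
    ultimately show ?thesis
      using b1 b2 unfolding BDF2_two_terms[OF n(1)] w unfolding dq_def nn p_def[symmetric] q_def[symmetric]
      by (simp add: power_mult_distrib)
  qed
  show ?thesis by (rule that[of "32 * K" "4 * K3"]) (use main K K30 in auto)
qed

theorem theorem2p3:
  fixes f :: "real \<Rightarrow> real \<Rightarrow> real" and v :: "real \<Rightarrow> real" and v0 T L M :: real
  assumes T_pos: "T > 0"
    and L_pos: "L > 0"
    and lipschitz: "\<And>s. s \<in> {0..T} \<Longrightarrow> L-lipschitz_on UNIV (f s)"
    and f_C2: "Ck_on 2 ({0..T} \<times> UNIV) (\<lambda>(s, y). f s y)"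
    and exact: "ivp_solution f v0 T v"
    and v_C4: "Ck_on 4 {0<..T} v"
    and v_C4_bounded: "bounded ((deriv ^^ 4) v ` {0<..<T})"
  shows "\<exists>C>0. \<forall>N t v2 v3.
    is_mesh T N t \<longrightarrow>
    max_step N t \<le> 1 / (4 * L) \<longrightarrow>
    bdf2_solution f v0 N t v2 \<longrightarrow>
    bdf2_dc3_solution f v0 N t v2 v3 \<longrightarrow>
    \<bar>err v t v2 1\<bar> \<le> M \<longrightarrow>
    max_step N t * \<bar>dq t (err v t v2) 1\<bar> \<le> M \<longrightarrow>
    (\<forall>n\<in>{2..N}.
      \<bar>err v t v3 n\<bar> \<le> C * exp (4 * L * t (n - 1)) *
        (\<bar>err v t v3 1\<bar> + max_step N t * \<bar>dq t (err v t v3) 1\<bar>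
         + max_step N t * \<bar>err v t v2 1\<bar>
         + max_step N t * (max_step N t + sigma3 t n) * \<bar>dq t (err v t v2) 1\<bar>
         + t n * max_step N t ^ 3))"
proof -

  \<comment> \<open>Problem data and the constants fixed before the mesh\<close>
  have v_cont: "continuous_on {0..T} v" and v_init: "v 0 = v0"
    and v': "\<And>s. s \<in> {0<..T} \<Longrightarrow> (v has_real_derivative f s (v s)) (at s within {0..T})"
    using exact by (auto simp: ivp_solution_def)
  have F_cont: "continuous_on {0..T} (\<lambda>s. f s (v s))"
  proof -
    have "continuous_on {0..T} (\<lambda>s. (s, v s))" by (intro continuous_intros v_cont)
    from continuous_on_compose2[OF Ck_on_imp_continuous_on[OF f_C2] this] show ?thesis by auto
  qed
  have v'': "(v has_real_derivative f s (v s)) (at s within {0<..T})" if "s \<in> {0<..T}" for s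
    by (rule DERIV_subset[OF v'[OF that]]) auto
  have lip: "\<bar>f s y - f s z\<bar> \<le> L * \<bar>y - z\<bar>" if "s \<in> {0..T}" for s y z
    using lipschitz_onD[OF lipschitz[OF that], of y z] by (simp add: dist_real_def)
  obtain K K' where K: "K \<ge> 0" "K' \<ge> 0"
    and trunc: "\<And>N t n. is_mesh T N t \<Longrightarrow> 2 \<le> n \<Longrightarrow> n \<le> N \<Longrightarrow>
      \<bar>BDF2 t (\<lambda>k. v (t k)) n + step t n / 3 * (dq t (\<lambda>k. f (t k) (v (t k))) n
          - dq t (\<lambda>k. f (t k) (v (t k))) (n - 1)) - f (t n) (v (t n))\<bar>
        \<le> K * max_step N t ^ 3"
    and corr: "\<And>N t n. is_mesh T N t \<Longrightarrow> 2 \<le> n \<Longrightarrow> n \<le> N \<Longrightarrow>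
      \<bar>step t n / 3 * (dq t (\<lambda>k. f (t k) (v (t k))) n - dq t (\<lambda>k. f (t k) (v (t k))) (n - 1))\<bar>
        \<le> K' * (max_step N t)\<^sup>2"
    by (rule exact_solution_truncation[OF T_pos v_cont F_cont v' v_C4 v_C4_bounded]) blast+
  define G where "G = exp (2 * L * T)"
  define \<kappa> where "\<kappa> = K / (4 * L) + K'"
  \<comment> \<open>An a priori bound for the BDF2 errors on every admissible mesh: the two starting
    terms are at most \<open>M\<close> each, and the maximal step is at most
    \<open>1 / (4 * L)\<close>. It must precede \<open>K2\<close>, which depends on it.\<close>
  define R where "R = G * (M + M + \<kappa> * (1 / (4 * L))\<^sup>2 * T)"
  obtain K2 where K2: "K2 \<ge> 0" and incr: "\<And>s s' e. 0 \<le> s \<Longrightarrow> s < s' \<Longrightarrow> s' \<le> T \<Longrightarrow> \<bar>e\<bar> \<le> R \<Longrightarrow>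
    \<bar>(f s' (v s') - f s' (v s' - e)) - (f s (v s) - f s (v s - e))\<bar> \<le> K2 * \<bar>e\<bar> * (s' - s)"
    by (rule increment_of_error[OF f_C2 v_cont v'' F_cont, of R]) (assumption | rule that)+
  \<comment> \<open>These are the coefficients of \<open>\<tau> ^ 3\<close> and of
    \<open>\<tau> * W\<close> in the later perturbation \<open>A3\<close>. The constant
    \<open>C\<close> is \<open>G\<close> times the sum of the coefficients of all error
    terms.\<close>
  define \<alpha> \<beta> where "\<alpha> = K + L * \<kappa>" and "\<beta> = L\<^sup>2 + K2"
  define C where "C = G * (1 + 4 * L + \<beta> * G * T + (\<alpha> + \<beta> * G * T * \<kappa>))"
  have G: "G \<ge> 1" using L_pos T_pos by (simp add: G_def)
  have \<kappa>: "\<kappa> \<ge> 0" using K L_pos by (simp add: \<kappa>_def)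
  have \<alpha>\<beta>: "\<alpha> \<ge> 0" "\<beta> \<ge> 0" using K K2 \<kappa> L_pos by (auto simp: \<alpha>_def \<beta>_def)
  have nonneg: "\<beta> * G * T \<ge> 0" "\<beta> * G * T * \<kappa> \<ge> 0" using G \<kappa> \<alpha>\<beta> T_pos by simp_all
  have C: "C > 0" using G nonneg \<alpha>\<beta> L_pos unfolding C_def by (intro mult_pos_pos) linarith+
  have bound: "\<bar>err v t v3 n\<bar> \<le> C * exp (4 * L * t (n - 1)) *
        (\<bar>err v t v3 1\<bar> + max_step N t * \<bar>dq t (err v t v3) 1\<bar>
         + max_step N t * \<bar>err v t v2 1\<bar>
         + max_step N t * (max_step N t + sigma3 t n) * \<bar>dq t (err v t v2) 1\<bar>
         + t n * max_step N t ^ 3)"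
    if mesh: "is_mesh T N t" and small: "max_step N t \<le> 1 / (4 * L)"
      and s2: "bdf2_solution f v0 N t v2" and s3: "bdf2_dc3_solution f v0 N t v2 v3"
      and start: "\<bar>err v t v2 1\<bar> \<le> M" "max_step N t * \<bar>dq t (err v t v2) 1\<bar> \<le> M"
      and n: "n \<in> {2..N}" for N t v2 v3 n
  proof -

    \<comment> \<open>BDF2 errors and their difference quotients on a fixed mesh\<close>
    note m = is_mesh_facts[OF mesh]
    define \<tau> where "\<tau> = max_step N t"
    have \<tau>: "\<tau> > 0" "\<tau> \<le> 1 / (4 * L)" "L * \<tau> \<le> 1 / 4"
      using m(3) small L_pos by (auto simp: \<tau>_def field_simps)
    have t0: "t 0 = 0" using mesh by (simp add: is_mesh_def)
    define e2 e3 where "e2 = err v t v2" and "e3 = err v t v3"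
    define E1 X1 where "E1 = \<bar>e2 1\<bar>" and "X1 = \<bar>dq t e2 1\<bar>"
    have EX: "E1 \<ge> 0" "X1 \<ge> 0" by (auto simp: E1_def X1_def)
    \<comment> \<open>The value 0 set by \<open>err\<close> at index 0 agrees with the pointwise
      difference because \<open>v 0 = v0\<close>.\<close>
    have e2: "e2 = (\<lambda>k. v (t k) - v2 k)" and e20: "e2 0 = 0"
      using s2 v_init t0 by (auto simp: e2_def err_def bdf2_solution_def)
    have e3: "e3 = (\<lambda>k. v (t k) - v3 k)"
      using s3 v_init t0 by (auto simp: e3_def err_def bdf2_dc3_solution_def)
    define g where "g k = f (t k) (v (t k))" for k
    define h where "h k = g k - f (t k) (v2 k)" for k
    have tk: "t k \<in> {0..T}" if "k \<le> N" for k using m(5) that by simp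
    have \<tau>3: "K * \<tau> ^ 3 \<le> K / (4 * L) * \<tau>\<^sup>2"
    proof -
      have "K * \<tau>\<^sup>2 * \<tau> \<le> K * \<tau>\<^sup>2 * (1 / (4 * L))" using \<tau> K by (intro mult_left_mono) auto
      then show ?thesis by (simp add: power2_eq_square power3_eq_cube mult_ac)
    qed
    \<comment> \<open>The BDF2 truncation error is the corrected one minus the correction itself; in
      the cubic part one \<open>\<tau>\<close> is traded for \<open>1 / (4 * L)\<close>. The term
      \<open>0 / 2 ^ k\<close> fits the stability bound with \<open>B = 0\<close>.\<close>
    have F2: "\<bar>BDF2 t e2 k\<bar> \<le> L * \<bar>e2 k\<bar> + \<kappa> * \<tau>\<^sup>2 + 0 / 2 ^ k" if k: "2 \<le> k" "k \<le> N" for k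
    proof -
      have "BDF2 t e2 k = BDF2 t (\<lambda>k. v (t k)) k - f (t k) (v2 k)"
        using s2 k unfolding e2 BDF2_diff[OF k(1)] by (simp add: bdf2_solution_def)
      moreover have "\<bar>g k - f (t k) (v2 k)\<bar> \<le> L * \<bar>e2 k\<bar>"
        using lip[OF tk[OF k(2)]] by (simp add: g_def e2)
      ultimately have "\<bar>BDF2 t e2 k\<bar> \<le> L * \<bar>e2 k\<bar> + (K * \<tau> ^ 3 + K' * \<tau>\<^sup>2)"
        using trunc[OF mesh k] corr[OF mesh k] unfolding g_def \<tau>_def by linarith
      also have "\<dots> \<le> L * \<bar>e2 k\<bar> + \<kappa> * \<tau>\<^sup>2"
        using \<tau>3 by (simp add: \<kappa>_def distrib_right)
      finally show ?thesis by simp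
    qed
    have A2: "\<kappa> * \<tau>\<^sup>2 \<ge> 0" using \<kappa> by simp
    note stable = BDF2_stability[OF mesh less_imp_le[OF L_pos] _ _ \<tau>(3)[unfolded \<tau>_def], folded \<tau>_def G_def]
    have stable2: "\<bar>e2 k\<bar> \<le> G * (E1 + \<tau> * X1 + 2 * \<tau> * 0 + \<kappa> * \<tau>\<^sup>2 * t k)"
      "\<bar>dq t e2 k\<bar> \<le> X1 / 2 ^ (k - 1) + L * (G * (E1 + \<tau> * X1 + 2 * \<tau> * 0 + \<kappa> * \<tau>\<^sup>2 * t k))
        + \<kappa> * \<tau>\<^sup>2 + 0 * k / 2 ^ k" if "1 \<le> k" "k \<le> N" for k
      unfolding E1_def X1_def
      by (rule stable(1)[OF A2 order_refl _ that], rule F2; assumption)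
        (rule stable(2)[OF A2 order_refl _ that], rule F2; assumption)
    define W where "W = G * (E1 + \<tau> * X1 + \<kappa> * \<tau>\<^sup>2 * T)"
    have W_ge: "G * (E1 + \<tau> * X1 + 2 * \<tau> * 0 + \<kappa> * \<tau>\<^sup>2 * t k) \<le> W" if "k \<le> N" for k
      unfolding W_def using tk[OF that] G A2 mult_left_mono[of "t k" T "\<kappa> * \<tau>\<^sup>2"]
      by (intro mult_left_mono) auto
    have W0: "W \<ge> 0"
      unfolding W_def using G EX \<tau> \<kappa> T_pos by (intro mult_nonneg_nonneg add_nonneg_nonneg) auto
    have e2_bound: "\<bar>e2 k\<bar> \<le> W" if "k \<le> N" for k
      using stable2(1)[of k] W_ge[of k] that W0 e20 by (cases "k = 0") auto
    have x2_bound: "\<bar>dq t e2 k\<bar> \<le> X1 / 2 ^ (k - 1) + (L * W + \<kappa> * \<tau>\<^sup>2)" if "1 \<le> k" "k \<le> N" for k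
      using stable2(2)[OF that] mult_left_mono[OF W_ge[OF that(2)] less_imp_le[OF L_pos]] by simp
    have WR: "W \<le> R"
    proof -
      have "\<kappa> * \<tau>\<^sup>2 * T \<le> \<kappa> * (1 / (4 * L))\<^sup>2 * T"
        using \<tau> \<kappa> T_pos by (intro mult_right_mono mult_left_mono power_mono) auto
      then show ?thesis
        unfolding W_def R_def using start G
        by (intro mult_left_mono add_mono) (auto simp: E1_def X1_def e2_def \<tau>_def)
    qed
    \<comment> \<open>The jump of \<open>h\<close> splits into the change of \<open>f\<close> at the
      fixed time \<open>t k\<close> as the error moves from index \<open>k - 1\<close> to
      \<open>k\<close>, which is Lipschitz, and the increment in time with the error frozen, which
      \<open>K2\<close> controls.\<close>
    have h_bound: "\<bar>dq t h k\<bar> \<le> L * \<bar>dq t e2 k\<bar> + K2 * W" if k: "1 \<le> k" "k \<le> N" for k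
    proof -
      let ?s = "t (k - 1)" and ?s' = "t k" and ?e = "e2 (k - 1)"
      have eW: "\<bar>?e\<bar> \<le> W" by (rule e2_bound) (use k in simp)
      have step: "step t k > 0" using m(1) k by simp
      then have s: "0 \<le> ?s" "?s < ?s'" "?s' \<le> T" using tk[of k] tk[of "k - 1"] k by (auto simp: step_def)
      have "h k - h (k - 1) = (f ?s' (v ?s' - ?e) - f ?s' (v2 k))
          + ((f ?s' (v ?s') - f ?s' (v ?s' - ?e)) - (f ?s (v ?s) - f ?s (v ?s - ?e)))"
        by (simp add: h_def g_def e2)
      moreover have "\<bar>f ?s' (v ?s' - ?e) - f ?s' (v2 k)\<bar> \<le> L * \<bar>e2 k - ?e\<bar>"
        using lip[OF tk[OF k(2)], of "v ?s' - ?e" "v2 k"] by (simp add: e2 algebra_simps)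
      moreover have "\<bar>(f ?s' (v ?s') - f ?s' (v ?s' - ?e)) - (f ?s (v ?s) - f ?s (v ?s - ?e))\<bar>
          \<le> K2 * \<bar>?e\<bar> * (?s' - ?s)"
        using eW WR by (intro incr s) linarith
      moreover have "K2 * \<bar>?e\<bar> * (?s' - ?s) \<le> K2 * W * step t k"
        unfolding step_def using eW K2 s by (intro mult_right_mono mult_left_mono) auto
      ultimately have "\<bar>h k - h (k - 1)\<bar> \<le> L * \<bar>e2 k - ?e\<bar> + K2 * W * step t k" by linarith
      then have "\<bar>h k - h (k - 1)\<bar> / step t k \<le> (L * \<bar>e2 k - ?e\<bar> + K2 * W * step t k) / step t k"
        using step by (intro divide_right_mono) auto
      then show ?thesis using step by (simp add: dq_def add_divide_distrib)
    qed

    \<comment> \<open>Residual of the BDF2-DC3 error equation\<close>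
    define A3 where "A3 = \<alpha> * \<tau> ^ 3 + \<beta> * \<tau> * W"
    define B3 where "B3 = 2 * L * \<tau> * X1"
    have F3: "\<bar>BDF2 t e3 k\<bar> \<le> L * \<bar>e3 k\<bar> + A3 + B3 / 2 ^ k" if k: "2 \<le> k" "k \<le> N" for k
    proof -
      have steps: "step t k > 0" "step t (k - 1) > 0" "step t k \<le> \<tau>"
        using m(1)[of k] m(1)[of "k - 1"] m(2)[of k] k by (auto simp: \<tau>_def)
      have dq_h: "dq t h j = dq t g j - dq t (\<lambda>i. f (t i) (v2 i)) j" for j
        unfolding h_def dq_def by (simp add: diff_divide_distrib)
      have "BDF2 t e3 k = BDF2 t (\<lambda>k. v (t k)) k + DC23 f t v2 k - f (t k) (v3 k)"
        using s3 k unfolding e3 BDF2_diff[OF k(1)] by (force simp: bdf2_dc3_solution_def)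
      also have "\<dots> = (g k - f (t k) (v3 k))
          + (BDF2 t (\<lambda>k. v (t k)) k + step t k / 3 * (dq t g k - dq t g (k - 1)) - g k)
          - step t k / 3 * (dq t h k - dq t h (k - 1))"
        unfolding DC23_eq_dq[OF k(1) steps(1,2)] dq_h by (simp add: right_diff_distrib)
      \<comment> \<open>The correction on the BDF2 data is the one on the exact data minus the one
        on \<open>h\<close>; the former belongs to the third-order truncation error.\<close>
      finally have split: "BDF2 t e3 k = (g k - f (t k) (v3 k))
          + (BDF2 t (\<lambda>k. v (t k)) k + step t k / 3 * (dq t g k - dq t g (k - 1)) - g k)
          - step t k / 3 * (dq t h k - dq t h (k - 1))" .
      have "\<bar>g k - f (t k) (v3 k)\<bar> \<le> L * \<bar>e3 k\<bar>"
        using lip[OF tk[OF k(2)]] by (simp add: g_def e3)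
      moreover have "\<bar>BDF2 t (\<lambda>k. v (t k)) k + step t k / 3 * (dq t g k - dq t g (k - 1)) - g k\<bar> \<le> K * \<tau> ^ 3"
        using trunc[OF mesh k] unfolding g_def \<tau>_def by simp
      moreover have "\<bar>step t k / 3 * (dq t h k - dq t h (k - 1))\<bar>
          \<le> L * \<kappa> * \<tau> ^ 3 + \<beta> * \<tau> * W + B3 / 2 ^ k"
      proof -
        define Z where "Z = L * (L * W + \<kappa> * \<tau>\<^sup>2) + K2 * W"
        have Z: "Z \<ge> 0" using L_pos W0 A2 K2 by (simp add: Z_def)
        have dq_h_bound: "\<bar>dq t h j\<bar> \<le> L * (X1 / 2 ^ (j - 1)) + Z" if "1 \<le> j" "j \<le> N" for j
          using h_bound[OF that] mult_left_mono[OF x2_bound[OF that] less_imp_le[OF L_pos]]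
          unfolding Z_def distrib_left by linarith
        have "1 \<le> k - 1" "k - 1 \<le> N" "1 \<le> k" using k by auto
        then have "\<bar>dq t h k - dq t h (k - 1)\<bar>
            \<le> L * (X1 / 2 ^ (k - 1)) + L * (X1 / 2 ^ (k - 1 - 1)) + 2 * Z"
          using dq_h_bound[of k] dq_h_bound[of "k - 1"] k(2) by linarith
        \<comment> \<open>The two neighbouring powers add up to \<open>6 / 2 ^ k\<close>, which with
          the prefactor \<open>\<tau> / 3\<close> yields the 2 in \<open>B3\<close>.\<close>
        also have "\<dots> = 6 * (L * X1 / 2 ^ k) + 2 * Z"
        proof -
          obtain i where "k = Suc (Suc i)" using k(1) by (metis add_2_eq_Suc le_Suc_ex)
          then show ?thesis by simp
        qed
        finally have "\<bar>step t k / 3 * (dq t h k - dq t h (k - 1))\<bar> \<le> \<tau> / 3 * (6 * (L * X1 / 2 ^ k) + 2 * Z)"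
          unfolding abs_mult using steps by (intro mult_mono) auto
        also have "\<dots> = B3 / 2 ^ k + 2 / 3 * (\<tau> * Z)"
          by (simp add: B3_def algebra_simps)
        also have "2 / 3 * (\<tau> * Z) \<le> 1 * (\<tau> * Z)"
          using \<tau> Z by (intro mult_right_mono) auto
        also have "1 * (\<tau> * Z) = L * \<kappa> * \<tau> ^ 3 + \<beta> * \<tau> * W"
          by (simp add: Z_def \<beta>_def power2_eq_square power3_eq_cube algebra_simps)
        finally show ?thesis by simp
      qed
      ultimately have "\<bar>BDF2 t e3 k\<bar> \<le> L * \<bar>e3 k\<bar> + K * \<tau> ^ 3 + (L * \<kappa> * \<tau> ^ 3 + \<beta> * \<tau> * W + B3 / 2 ^ k)"
        unfolding split by linarith
      then show ?thesis by (simp add: A3_def \<alpha>_def distrib_right)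
    qed
    have A3: "A3 \<ge> 0" using \<alpha>\<beta> \<tau> W0 by (simp add: A3_def)
    have B3: "B3 \<ge> 0" using L_pos \<tau> EX by (simp add: B3_def)
    have t: "0 \<le> t n" "t n \<le> T" "0 \<le> t (n - 1)" using tk[of n] tk[of "n - 1"] n by auto
    have \<sigma>: "sigma3 t n \<ge> 0"
    proof (rule sigma3_nonneg)
      show "ratio t i \<ge> 0" if "2 \<le> i" "i \<le> n" for i
        unfolding ratio_def using that n by (intro divide_nonneg_nonneg m(1)[THEN less_imp_le]) auto
    qed

    \<comment> \<open>Collecting the error terms\<close>
    define a1 a2 a3 a4 a5 where "a1 = \<bar>e3 1\<bar>" and "a2 = \<tau> * \<bar>dq t e3 1\<bar>" and "a3 = \<tau> * E1"
      and "a4 = \<tau>\<^sup>2 * X1" and "a5 = t n * \<tau> ^ 3"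
    note a = a1_def a2_def a3_def a4_def a5_def
    have a0: "a1 \<ge> 0" "a2 \<ge> 0" "a3 \<ge> 0" "a4 \<ge> 0" "a5 \<ge> 0"
      using \<tau> EX t by (auto simp: a)
    have "A3 * t n = \<alpha> * a5 + \<beta> * G * (\<tau> * E1 + \<tau>\<^sup>2 * X1) * t n + \<beta> * G * T * \<kappa> * a5"
      by (simp add: A3_def W_def a algebra_simps power2_eq_square power3_eq_cube)
    also have "\<beta> * G * (\<tau> * E1 + \<tau>\<^sup>2 * X1) * t n \<le> \<beta> * G * (\<tau> * E1 + \<tau>\<^sup>2 * X1) * T"
      using t \<alpha>\<beta> G \<tau> EX by (intro mult_left_mono) auto
    finally have A3t: "A3 * t n \<le> (\<alpha> + \<beta> * G * T * \<kappa>) * a5 + \<beta> * G * T * (a3 + a4)"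
      by (simp add: a algebra_simps)
    define S where "S = a1 + a2 + a3 + a4 + a5"
    have S: "a1 + a2 \<le> S" "a4 \<le> S" "a3 + a4 \<le> S" "a5 \<le> S" using a0 by (auto simp: S_def)
    define c where "c = 1 + 4 * L + \<beta> * G * T + (\<alpha> + \<beta> * G * T * \<kappa>)"
    have "\<bar>e3 n\<bar> \<le> G * (a1 + a2 + 2 * \<tau> * B3 + A3 * t n)"
      unfolding a using n by (intro stable(1) A3 B3 F3) auto
    also have "\<dots> \<le> G * (c * S)"
    proof (rule mult_left_mono)
      \<comment> \<open>Summing the decaying part brings a second factor \<open>\<tau>\<close>, so
        its initial quotient enters only through \<open>a4\<close>.\<close>
      have "2 * \<tau> * B3 = 4 * L * a4" by (simp add: B3_def a power2_eq_square)
      then have "a1 + a2 + 2 * \<tau> * B3 + A3 * t n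
          \<le> (a1 + a2) + 4 * L * a4 + \<beta> * G * T * (a3 + a4) + (\<alpha> + \<beta> * G * T * \<kappa>) * a5"
        using A3t by linarith
      also have "\<dots> \<le> S + 4 * L * S + \<beta> * G * T * S + (\<alpha> + \<beta> * G * T * \<kappa>) * S"
        using S nonneg \<alpha>\<beta> L_pos by (intro add_mono mult_left_mono) auto
      finally show "a1 + a2 + 2 * \<tau> * B3 + A3 * t n \<le> c * S"
        by (simp add: c_def distrib_right)
    qed (use G in auto)
    also have "\<dots> = C * 1 * (a1 + a2 + a3 + a4 + a5)" by (simp add: C_def c_def S_def)
    \<comment> \<open>The growth already sits in \<open>G\<close>, a factor of \<open>C\<close>; the
      exponential enters as a number of at least 1, and \<open>sigma3 t n\<close> only enlarges the
      factor of \<open>X1\<close>.\<close>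
    also have "\<dots> \<le> C * exp (4 * L * t (n - 1)) * (a1 + a2 + a3 + \<tau> * (\<tau> + sigma3 t n) * X1 + a5)"
    proof (intro mult_mono add_mono order_refl)
      show "a4 \<le> \<tau> * (\<tau> + sigma3 t n) * X1"
        unfolding a power2_eq_square using \<tau> \<sigma> EX by (intro mult_right_mono mult_left_mono) auto
    qed (use C L_pos t a0 in auto)
    finally show ?thesis unfolding a \<tau>_def E1_def X1_def e2_def e3_def .
  qed
  show ?thesis using C bound by blast
qed

end
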